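(* Let $\Phi(z)=\sum_{n\ge0}z^{2^n}$, and let $\alpha$ be a positive integer. Then the generating function $S(z)=\sum_{n\ge0}s_{n+1}(PSL_2(\mathbb Z))\,z^n$, when reduced modulo $2^{3\cdot 2^\alpha}$, can be expressed as a polynomial in $\Phi(z)$ of degree at most $2^{\alpha+2}-1$ with coefficients that are Laurent polynomials in $z$ over the integers; that is, there exist $a_i(z)\in\mathbb Z[z,z^{-1}]$, $0\le i\le 2^{\alpha+2}-1$, such that $S(z)=\sum_{i=0}^{2^{\alpha+2}-1}a_i(z)\Phi^i(z)$ modulo $2^{3\cdot2^\alpha}$.
   Context: For a finitely generated group $\Gamma$, $s_n(\Gamma)$ denotes the number of subgroups of index $n$ in $\Gamma$. For formal Laurent series with integer coefficients, "$f(z)=g(z)$ modulo $M$" means that coefficients of equal powers of $z$ agree modulo $M$. $\Phi^i(z)$ denotes $(\Phi(z))^i$. *)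

theory Defs
  imports
    "HOL-Analysis.Determinants"
    "HOL-Algebra.Coset"
    "HOL-Computational_Algebra.Formal_Laurent_Series"
    "HOL-Number_Theory.Cong"
begin

definition SL2Z :: "(int ^ 2 ^ 2) monoid" where
  "SL2Z = \<lparr>carrier = {A. det A = 1}, mult = (**), one = mat 1\<rparr>"

definition PSL2Z :: "(int ^ 2 ^ 2) set monoid" where
  "PSL2Z = SL2Z Mod {mat 1, - mat 1}"

lemma group_SL2Z: "group SL2Z"
proof (rule groupI)
  fix A assume "A \<in> carrier SL2Z"
  then have d: "A$1$1 * A$2$2 - A$1$2 * A$2$1 = 1"
    by (simp add: SL2Z_def det_2)
  define B :: "int ^ 2 ^ 2" where
    "B = (\<chi> i j. if i = j then (if i = 1 then A$2$2 else A$1$1) else - A$i$j)"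
  have B: "B$1$1 = A$2$2" "B$2$2 = A$1$1" "B$1$2 = - A$1$2" "B$2$1 = - A$2$1"
    by (simp_all add: B_def)
  have "det B = 1"
    using d by (simp add: det_2 B algebra_simps)
  moreover have "B ** A = mat 1"
    using d by (simp add: vec_eq_iff matrix_matrix_mult_def mat_def forall_2 sum_2 B algebra_simps)
  ultimately show "\<exists>B\<in>carrier SL2Z. B \<otimes>\<^bsub>SL2Z\<^esub> A = \<one>\<^bsub>SL2Z\<^esub>"
    by (auto simp: SL2Z_def)
qed (auto simp: SL2Z_def det_mul matrix_mul_assoc)

lemma normal_pm_one: "{mat 1, - mat 1} \<lhd> SL2Z"
proof -
  interpret group SL2Z by (rule group_SL2Z)
  have neg: "A ** - B = - (A ** B)" "- A ** B = - (A ** B)" for A B :: "int ^ 2 ^ 2"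
    by (simp_all add: vec_eq_iff matrix_matrix_mult_def sum_negf)
  have c: "- mat 1 \<in> carrier SL2Z"
    by (simp add: SL2Z_def det_2 mat_def)
  have i: "inv\<^bsub>SL2Z\<^esub> (- mat 1) = - mat 1"
    by (rule inv_equality) (use c in \<open>auto simp: SL2Z_def neg\<close>)
  have one: "\<one>\<^bsub>SL2Z\<^esub> = mat 1"
    by (simp add: SL2Z_def)
  have sub: "subgroup {mat 1, - mat 1} SL2Z"
  proof (rule subgroupI)
    show "{mat 1, - mat 1} \<subseteq> carrier SL2Z"
      using c by (auto simp: SL2Z_def)
    show "inv\<^bsub>SL2Z\<^esub> A \<in> {mat 1, - mat 1}" if "A \<in> {mat 1, - mat 1}" for A
      using that i inv_one one by auto
  qed (auto simp: SL2Z_def neg)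
  show ?thesis
  proof (rule normalI[OF sub], intro ballI)
    fix A
    show "{mat 1, - mat 1} #>\<^bsub>SL2Z\<^esub> A = A <#\<^bsub>SL2Z\<^esub> {mat 1, - mat 1}"
      by (simp add: r_coset_def l_coset_def SL2Z_def neg)
  qed
qed

lemma group_PSL2Z: "group PSL2Z"
  unfolding PSL2Z_def by (rule normal.factorgroup_is_group[OF normal_pm_one])

(* finiteness keeps subgroups of infinite index, whose coset set has card 0, out of the count at n = 0 *)
definition subgroup_count :: "('a, 'b) monoid_scheme \<Rightarrow> nat \<Rightarrow> nat" where
  "subgroup_count G n =
     card {H. subgroup H G \<and> finite (rcosets\<^bsub>G\<^esub> H) \<and> card (rcosets\<^bsub>G\<^esub> H) = n}"

definition S_PSL2Z :: "int fls" where
  "S_PSL2Z = fps_to_fls (Abs_fps (\<lambda>n. int (subgroup_count PSL2Z (n + 1))))"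

definition Phi_fps :: "int fps" where
  "Phi_fps = Abs_fps (\<lambda>k. if \<exists>n. k = 2 ^ n then 1 else 0)"

lemma Phi_fps_sums: "(\<lambda>n. fps_X ^ (2 ^ n)) sums Phi_fps"
  unfolding sums_def
proof (rule tendsto_fpsI)
  fix k :: nat
  have "fps_nth (\<Sum>n<m. fps_X ^ (2 ^ n)) k = fps_nth Phi_fps k" if "m > k" for m
  proof -
    have "fps_nth (\<Sum>n<m. fps_X ^ (2 ^ n) :: int fps) k = (\<Sum>n<m. if k = 2 ^ n then 1 else 0)"
      by (simp add: fps_sum_nth fps_X_power_nth)
    also have "\<dots> = fps_nth Phi_fps k"
    proof (cases "\<exists>j. k = 2 ^ j")
      case True
      then obtain j where j: "k = 2 ^ j" by blast
      have "j < k" by (simp add: j)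
      then have "j < m" using that by simp
      then show ?thesis by (simp add: j Phi_fps_def)
    next
      case False
      then show ?thesis by (auto simp: Phi_fps_def)
    qed
    finally show ?thesis .
  qed
  then show "\<forall>\<^sub>F m in sequentially. fps_nth (\<Sum>n<m. fps_X ^ (2 ^ n)) k = fps_nth Phi_fps k"
    using eventually_gt_at_top[of k] by (rule eventually_mono[rotated])
qed

definition \<Phi> :: "int fls" where
  "\<Phi> = fps_to_fls Phi_fps"

definition laurent_polynomial :: "int fls \<Rightarrow> bool" where
  "laurent_polynomial f \<longleftrightarrow> finite {k. fls_nth f k \<noteq> 0}"

definition fls_cong :: "int fls \<Rightarrow> int fls \<Rightarrow> int \<Rightarrow> bool" where
  "fls_cong f g M \<longleftrightarrow> (\<forall>k. [fls_nth f k = fls_nth g k] (mod M))"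

end

theory Submission
  imports Defs "HOL-Combinatorics.Permutations" "HOL-Library.FuncSet"
begin

text \<open>
  The modular group is the free product of cyclic groups of order two and three, so its actions on
  \<open>n\<close> points are the pairs of permutations \<open>s\<close>, \<open>t\<close> with \<open>s\<^sup>2 = t\<^sup>3 = 1\<close>. Sorting these pairs by
  the stabiliser of a point gives \<open>H' = S H\<close> for the exponential generating function \<open>H\<close> of the
  numbers of pairs. The recurrences for these numbers give a second-order linear differential
  equation for \<open>H\<close>, that is, a Riccati equation for \<open>S\<close>. Its leading coefficient \<open>z\<^sup>7 (1 - z\<^sup>3)\<close>
  vanishes at the cube roots of unity, but these singularities are apparent: the substitution
  \<open>S = (1 - z\<^sup>3) W - 1 - 2 z\<^sup>2\<close> leads to a Riccati equation for \<open>W\<close> with leading coefficient \<open>z\<^sup>7\<close>.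

  Modulo \<open>2\<^sup>M\<close> the series \<open>\<Phi>'\<close> is a Laurent polynomial, so \<open>\<Phi>\<close> generates a differential
  ring. Let \<open>I\<close> be its ideal generated by \<open>2\<close> and \<open>\<omega> = \<Phi>\<^sup>2 - \<Phi> + z\<close>. As \<open>\<omega>\<close> is divisible by 2, all
  elements of \<open>I\<^sup>k\<close> are divisible by \<open>2\<^sup>k\<close>. The ideals \<open>I\<^sup>k\<close> are stable under derivation, the second
  derivation maps \<open>I\<^sup>k\<close> to \<open>I\<^bsup>k+1\<^esup>\<close>, and therefore the linearised equation can be inverted modulo
  \<open>I\<^bsup>k+1\<^esup>\<close> by an explicit first-order operator. Newton iteration then lifts an explicit solution
  modulo \<open>I\<close> to one modulo \<open>I\<^sup>M\<close>. It agrees with \<open>W\<close> modulo \<open>2\<^sup>M\<close>, since solutions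
  with the same reduction modulo 2 coincide. Working with \<open>I\<close>-adic instead of 2-adic
  approximations avoids dividing a polynomial in \<open>\<Phi>\<close> by 2. Finally \<open>\<Phi>\<close> satisfies a monic quartic
  equation modulo 8, whose \<open>2\<^sup>\<alpha>\<close>-th power is a monic equation of degree \<open>2\<^bsup>\<alpha>+2\<^esup>\<close> modulo
  \<open>8\<close> to the power \<open>2\<^sup>\<alpha>\<close>; this bounds the degree.
\<close>

section \<open>Generators and relations of the modular group\<close>

definition mat22 :: "int \<Rightarrow> int \<Rightarrow> int \<Rightarrow> int \<Rightarrow> int ^ 2 ^ 2" where
  "mat22 a b c d = (\<chi> i j. if i = 1 then (if j = 1 then a else b) else (if j = 1 then c else d))"

lemma mat22_nth [simp]: "mat22 a b c d $ 1 $ 1 = a" "mat22 a b c d $ 1 $ 2 = b"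
  "mat22 a b c d $ 2 $ 1 = c" "mat22 a b c d $ 2 $ 2 = d"
  by (simp_all add: mat22_def)

lemma mat22_cases: obtains a b c d where "A = mat22 a b c d"
proof
  show "A = mat22 (A $ 1 $ 1) (A $ 1 $ 2) (A $ 2 $ 1) (A $ 2 $ 2)"
    by (simp add: vec_eq_iff forall_2)
qed

lemma mat22_eq_iff [simp]: "mat22 a b c d = mat22 a' b' c' d' \<longleftrightarrow> a = a' \<and> b = b' \<and> c = c' \<and> d = d'"
  by (auto simp: vec_eq_iff forall_2)

lemma mat22_mult [simp]: "mat22 a b c d ** mat22 a' b' c' d' =
    mat22 (a * a' + b * c') (a * b' + b * d') (c * a' + d * c') (c * b' + d * d')"
  by (simp add: vec_eq_iff forall_2 matrix_matrix_mult_def sum_2)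

lemma mat22_uminus [simp]: "- mat22 a b c d = mat22 (- a) (- b) (- c) (- d)"
  by (simp add: vec_eq_iff forall_2)

lemma mat_1_eq_mat22: "mat 1 = mat22 1 0 0 1"
  by (simp add: vec_eq_iff forall_2 mat_def mat22_def)

lemma det_mat22 [simp]: "det (mat22 a b c d) = a * d - b * c"
  by (simp add: det_2)

lemma matrix_mult_uminus:
  fixes A B :: "int ^ 2 ^ 2"
  shows "A ** - B = - (A ** B)" "- A ** B = - (A ** B)"
  by (simp_all add: vec_eq_iff matrix_matrix_mult_def sum_negf)

definition mat_S :: "int ^ 2 ^ 2" where "mat_S = mat22 0 (-1) 1 0"
definition mat_U :: "int ^ 2 ^ 2" where "mat_U = mat22 0 (-1) 1 1"

lemma mat_S_square: "A ** mat_S ** mat_S = - A" for A :: "int ^ 2 ^ 2"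
  by (rule mat22_cases[of A]) (simp add: mat_S_def)

lemma mat_U_cube: "A ** mat_U ** mat_U ** mat_U = - A" for A :: "int ^ 2 ^ 2"
  by (rule mat22_cases[of A]) (simp add: mat_U_def)

text \<open>Euclidean algorithm on the first row: right multiplication by a power of
  \<open>mat22 1 1 0 1\<close>, which is - S U, adds a multiple of a to b, and S exchanges the two
  columns up to sign, so the upper left entry can be brought down to 0. Inverses of generators are
  available as positive words up to sign.\<close>

lemma SL2Z_induct [consumes 1, case_names one uminus S U]:
  fixes A :: "int ^ 2 ^ 2"
  assumes "det A = 1" and one: "P (mat 1)" and neg: "\<And>A. P A \<Longrightarrow> P (- A)"
    and S: "\<And>A. P A \<Longrightarrow> P (A ** mat_S)" and U: "\<And>A. P A \<Longrightarrow> P (A ** mat_U)"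
  shows "P A"
proof -
  have T1: "P (A ** mat22 1 1 0 1)" if "P A" for A
  proof -
    have "A ** mat22 1 1 0 1 = - (A ** mat_S ** mat_U)"
      by (rule mat22_cases[of A]) (simp add: mat_S_def mat_U_def)
    then show ?thesis using that by (simp add: neg S U)
  qed
  have T2: "P (A ** mat22 1 (-1) 0 1)" if "P A" for A
  proof -
    have "A ** mat22 1 (-1) 0 1 = - (A ** mat_U ** mat_U ** mat_S)"
      by (rule mat22_cases[of A]) (simp add: mat_S_def mat_U_def)
    then show ?thesis using that by (simp add: neg S U)
  qed
  have T: "P (A ** mat22 1 k 0 1)" if "P A" for A k
  proof (induction k rule: int_induct[of _ 0])
    case base
    then show ?case using that mat_1_eq_mat22 by (metis matrix_mul_rid)
  next
    case (step1 i)
    have "A ** mat22 1 (i + 1) 0 1 = (A ** mat22 1 i 0 1) ** mat22 1 1 0 1"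
      by (simp flip: matrix_mul_assoc add: add.commute)
    then show ?case using T1 step1 by simp
  next
    case (step2 i)
    have "A ** mat22 1 (i - 1) 0 1 = (A ** mat22 1 i 0 1) ** mat22 1 (-1) 0 1"
      by (simp flip: matrix_mul_assoc)
    then show ?case using T2 step2 by simp
  qed
  have "P (mat22 a b c d)" if "a * d - b * c = 1" for a b c d
    using that
  proof (induction "nat \<bar>a\<bar>" arbitrary: a b c d rule: less_induct)
    case less
    show ?case
    proof (cases "a = 0")
      case True
      then have "b * (- c) = 1" using less.prems by simp
      then have "b = 1 \<and> - c = 1 \<or> b = - 1 \<and> - c = - 1" by (simp only: zmult_eq_1_iff)
      then consider "b = 1" "c = -1" | "b = -1" "c = 1" by linarith
      then show ?thesis
      proof cases
        case 1
        then have "mat22 a b c d = - (mat 1 ** mat_S ** mat22 1 (- d) 0 1)"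
          using True by (simp add: mat_S_def mat_1_eq_mat22)
        then show ?thesis using T neg S one by metis
      next
        case 2
        then have "mat22 a b c d = mat 1 ** mat_S ** mat22 1 d 0 1"
          using True by (simp add: mat_S_def mat_1_eq_mat22)
        then show ?thesis using T neg S one by metis
      qed
    next
      case False
      \<comment> \<open>The remainder b' of b modulo a becomes the upper left entry of a matrix
        covered by the induction hypothesis. As \<open>mat_S\<close> has order four, three factors S
        undo the exchange of columns, and \<open>mat22 1 k 0 1\<close> restores b.\<close>
      define k where "k = b div a"
      define b' where "b' = b mod a"
      have b: "b = a * k + b'" by (simp add: k_def b'_def)
      have "\<bar>b'\<bar> < \<bar>a\<bar>" using False by (simp add: b'_def abs_mod_less)
      moreover have "b' * (- c) - (- a) * (d - c * k) = 1"
        using less.prems by (simp add: b algebra_simps)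
      ultimately have "P (mat22 b' (- a) (d - c * k) (- c))"
        by (intro less.hyps) auto
      then have "P (mat22 b' (- a) (d - c * k) (- c) ** mat_S ** mat_S ** mat_S ** mat22 1 k 0 1)"
        by (intro T neg S)
      moreover have "mat22 b' (- a) (d - c * k) (- c) ** mat_S ** mat_S ** mat_S ** mat22 1 k 0 1 = mat22 a b c d"
        by (simp add: mat_S_def b algebra_simps)
      ultimately show ?thesis by simp
    qed
  qed
  then show ?thesis using assms(1) by (cases A rule: mat22_cases) simp
qed

section \<open>Free product structure: evaluation of words and normal forms\<close>

text \<open>The relation pairs the matrix of a word with the value of the same word in s and t. A
  new letter is composed on the left, so words act from left to right; signs are discarded in view
  of the quotient PSL_2(Z).\<close>

inductive word_act :: "('a \<Rightarrow> 'a) \<Rightarrow> ('a \<Rightarrow> 'a) \<Rightarrow> int ^ 2 ^ 2 \<Rightarrow> ('a \<Rightarrow> 'a) \<Rightarrow> bool"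
  for s t where
  one: "word_act s t (mat 1) id"
| uminus: "word_act s t A p \<Longrightarrow> word_act s t (- A) p"
| S: "word_act s t A p \<Longrightarrow> word_act s t (A ** mat_S) (s \<circ> p)"
| U: "word_act s t A p \<Longrightarrow> word_act s t (A ** mat_U) (t \<circ> p)"

inductive positive_word :: "('a \<Rightarrow> 'a) \<Rightarrow> ('a \<Rightarrow> 'a) \<Rightarrow> int ^ 2 ^ 2 \<Rightarrow> ('a \<Rightarrow> 'a) \<Rightarrow> bool"
  for s t where
  one: "positive_word s t (mat 1) id"
| SU: "positive_word s t A p \<Longrightarrow> positive_word s t (A ** mat22 1 1 0 1) (t \<circ> s \<circ> p)"
| SUU: "positive_word s t A p \<Longrightarrow> positive_word s t (A ** mat22 1 0 1 1) (t \<circ> t \<circ> s \<circ> p)"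

text \<open>After the factor \<open>mat22 1 1 0 1\<close> the first row is (a, a + b), after
  \<open>mat22 1 0 1 1\<close> the second row is (c + d, d). For nonnegative entries neither is a
  row of the identity matrix, so only the empty word gives \<open>mat 1\<close>.\<close>

lemma positive_word_entries:
  assumes "positive_word s t A p"
  shows "\<exists>a b c d. A = mat22 a b c d \<and> a \<ge> 0 \<and> b \<ge> 0 \<and> c \<ge> 0 \<and> d \<ge> 0 \<and> (A = mat 1 \<longrightarrow> p = id)"
  using assms
proof induction
  case one
  then show ?case by (simp add: mat_1_eq_mat22) 
next
  case (SU A p)
  then show ?case by (auto simp: mat_1_eq_mat22)
next
  case (SUU A p)
  then show ?case by (auto simp: mat_1_eq_mat22)
qed

text \<open>Every word is, up to sign, a power of \<open>U\<close> times a product of matrices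
  \<open>- S U\<close> and \<open>- S U\<^sup>2\<close>, which have nonnegative entries, times a power of \<open>S\<close>.\<close>

definition normal_form :: "('a \<Rightarrow> 'a) \<Rightarrow> ('a \<Rightarrow> 'a) \<Rightarrow> int ^ 2 ^ 2 \<Rightarrow> ('a \<Rightarrow> 'a) \<Rightarrow> bool" where
  "normal_form s t A p \<longleftrightarrow> (\<exists>B q X u Y v. positive_word s t B q \<and>
     (X, u) \<in> {(mat 1, id), (mat_U, t), (mat_U ** mat_U, t \<circ> t)} \<and> (Y, v) \<in> {(mat 1, id), (mat_S, s)} \<and>
     A \<in> {X ** B ** Y, - (X ** B ** Y)} \<and> p = v \<circ> q \<circ> u)"

lemma normal_formI:
  assumes "positive_word s t B q"
    and "(X, u) \<in> {(mat 1, id), (mat_U, t), (mat_U ** mat_U, t \<circ> t)}"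
    and "(Y, v) \<in> {(mat 1, id), (mat_S, s)}"
  shows "normal_form s t (X ** B ** Y) (v \<circ> q \<circ> u)"
  unfolding normal_form_def using assms by blast

lemma normal_form_uminus:
  assumes "normal_form s t A p" shows "normal_form s t (- A) p"
proof -
  obtain B q X u Y v where *: "positive_word s t B q"
     "(X, u) \<in> {(mat 1, id), (mat_U, t), (mat_U ** mat_U, t \<circ> t)}" "(Y, v) \<in> {(mat 1, id), (mat_S, s)}"
     "A \<in> {X ** B ** Y, - (X ** B ** Y)}" "p = v \<circ> q \<circ> u"
    using assms unfolding normal_form_def by blast
  then have "- A \<in> {X ** B ** Y, - (X ** B ** Y)}" by auto
  with * show ?thesis unfolding normal_form_def by blast
qed

lemma normal_form_S:
  assumes s: "s \<circ> s = id" and "normal_form s t A p"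
  shows "normal_form s t (A ** mat_S) (s \<circ> p)"
proof -
  obtain B q X u Y v where B: "positive_word s t B q"
     and X: "(X, u) \<in> {(mat 1, id), (mat_U, t), (mat_U ** mat_U, t \<circ> t)}"
     and Y: "(Y, v) \<in> {(mat 1, id), (mat_S, s)}"
     and A: "A \<in> {X ** B ** Y, - (X ** B ** Y)}" "p = v \<circ> q \<circ> u"
    using assms unfolding normal_form_def by blast
  have "normal_form s t (X ** B ** Y ** mat_S) (s \<circ> (v \<circ> q \<circ> u))"
  proof (cases "Y = mat 1 \<and> v = id")
    case True
    then show ?thesis using normal_formI[OF B X, of mat_S s] by (simp add: comp_assoc)
  next
    case False
    then have "Y = mat_S" "v = s" using Y by auto
    moreover have "s \<circ> (s \<circ> q \<circ> u) = id \<circ> q \<circ> u"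
      using s by (simp flip: comp_assoc)
    ultimately show ?thesis
      using normal_form_uminus[OF normal_formI[OF B X, of "mat 1" id]] by (simp add: mat_S_square)
  qed
  then show ?thesis
    using A normal_form_uminus by (auto simp: matrix_mult_uminus)
qed

text \<open>The end of the word decides: a final S becomes a syllable S U, a final S U becomes S
  U^2, and a final S U^2 shrinks to S because U^3 = -1. If there is neither a syllable nor an S, the
  initial power of U changes.\<close>

lemma normal_form_U:
  assumes t: "t \<circ> t \<circ> t = id" and "normal_form s t A p"
  shows "normal_form s t (A ** mat_U) (t \<circ> p)"
proof -
  obtain B q X u Y v where B: "positive_word s t B q"
     and X: "(X, u) \<in> {(mat 1, id), (mat_U, t), (mat_U ** mat_U, t \<circ> t)}"
     and Y: "(Y, v) \<in> {(mat 1, id), (mat_S, s)}"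
     and A: "A \<in> {X ** B ** Y, - (X ** B ** Y)}" "p = v \<circ> q \<circ> u"
    using assms unfolding normal_form_def by blast
  have SU: "C ** mat_S ** mat_U = - (C ** mat22 1 1 0 1)"
    and SUU: "C ** mat22 1 1 0 1 ** mat_U = C ** mat22 1 0 1 1"
    and SUUU: "C ** mat22 1 0 1 1 ** mat_U = C ** mat_S" for C :: "int ^ 2 ^ 2"
    by (rule mat22_cases[of C]; simp add: mat_S_def mat_U_def)+
  have t': "t \<circ> (t \<circ> (t \<circ> f)) = f" for f
    using t by (simp flip: comp_assoc)
  have "normal_form s t (X ** B ** Y ** mat_U) (t \<circ> (v \<circ> q \<circ> u))"
  proof (cases "Y = mat 1 \<and> v = id")
    case False
    then have "Y = mat_S" "v = s" using Y by auto
    then show ?thesis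
      using normal_form_uminus[OF normal_formI[OF positive_word.SU[OF B] X, of "mat 1" id]]
      by (simp add: SU comp_assoc matrix_mul_assoc)
  next
    case True
    from B show ?thesis
    proof cases
      case one
      show ?thesis
        using X True one normal_formI[OF B, of mat_U t "mat 1" id]
          normal_formI[OF B, of "mat_U ** mat_U" "t \<circ> t" "mat 1" id]
          normal_form_uminus[OF normal_formI[OF B, of "mat 1" id "mat 1" id]]
        by (auto simp: t'[of id, simplified] mat_U_cube[of "mat 1", simplified] comp_assoc)
    next
      case (SU C r)
      then show ?thesis
        using True normal_formI[OF positive_word.SUU[OF SU(3)] X, of "mat 1" id]
        by (simp add: matrix_mul_assoc comp_assoc SUU)
    next
      case (SUU C r)
      then show ?thesis
        using True normal_formI[OF SUU(3) X, of mat_S s]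
        by (simp add: matrix_mul_assoc comp_assoc SUUU t')
    qed
  qed
  then show ?thesis
    using A normal_form_uminus by (auto simp: matrix_mult_uminus)
qed

lemma word_act_normal_form:
  assumes "s \<circ> s = id" and "t \<circ> t \<circ> t = id" and "word_act s t A p"
  shows "normal_form s t A p"
  using assms(3)
proof induction
  case one
  then show ?case using normal_formI[OF positive_word.one, of "mat 1" id t "mat 1" id s] by (simp add: id_def comp_def)
next
  case (uminus A p)
  show ?case by (rule normal_form_uminus[OF uminus.IH])
next
  case (S A p)
  show ?case by (rule normal_form_S[OF assms(1) S.IH])
next
  case (U A p)
  show ?case by (rule normal_form_U[OF assms(2) U.IH])
qed

text \<open>If X or Y is nontrivial, X^-1 Y^-1 has entries of both signs and cannot be B or - B. If
  both are trivial, nonnegativity excludes B = -1, and B = 1 comes from the empty word.\<close>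

lemma normal_form_mat_1:
  assumes "normal_form s t (mat 1) p"
  shows "p = id"
proof -
  obtain B q X u Y v where B: "positive_word s t B q"
     and X: "(X, u) \<in> {(mat 1, id), (mat_U, t), (mat_U ** mat_U, t \<circ> t)}"
     and Y: "(Y, v) \<in> {(mat 1, id), (mat_S, s)}"
     and A: "mat 1 \<in> {X ** B ** Y, - (X ** B ** Y)}" and p: "p = v \<circ> q \<circ> u"
    using assms unfolding normal_form_def by blast
  obtain a b c d where *: "B = mat22 a b c d" "a \<ge> 0" "b \<ge> 0" "c \<ge> 0" "d \<ge> 0" "B = mat 1 \<longrightarrow> q = id"
    using positive_word_entries[OF B] by blast
  then have "X = mat 1 \<and> u = id \<and> Y = mat 1 \<and> v = id \<and> B = mat 1"
    using X Y A by (auto simp: mat_1_eq_mat22 mat_S_def mat_U_def)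
  then show ?thesis using p * by simp
qed

lemma word_act_mat_1:
  assumes "s \<circ> s = id" and "t \<circ> t \<circ> t = id" and "word_act s t (mat 1) p"
  shows "p = id"
  by (rule normal_form_mat_1[OF word_act_normal_form[OF assms]])

lemma word_act_mult:
  assumes "word_act s t A p" and "word_act s t B q"
  shows "word_act s t (A ** B) (q \<circ> p)"
  using assms(2)
proof induction
  case one
  show ?case using assms(1) by (simp only: matrix_mul_rid id_comp)
next
  case (uminus B q)
  show ?case unfolding matrix_mult_uminus by (rule word_act.uminus[OF uminus.IH])
next
  case (S B q)
  show ?case unfolding matrix_mul_assoc comp_assoc by (rule word_act.S[OF S.IH])
next
  case (U B q)
  show ?case unfolding matrix_mul_assoc comp_assoc by (rule word_act.U[OF U.IH])
qed

text \<open>Inverse words are built from S^-1 = - S and U^-1 = - U^2. They reduce uniqueness of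
  values to the identity matrix.\<close>

lemma word_act_inverse:
  assumes s: "s \<circ> s = id" and t: "t \<circ> t \<circ> t = id" and "word_act s t A p"
  shows "\<exists>B r. word_act s t B r \<and> A ** B = mat 1 \<and> p \<circ> r = id"
  using assms(3)
proof induction
  case one
  show ?case by (rule exI[of _ "mat 1"], rule exI[of _ id]) (simp add: word_act.one del: id_apply)
next
  case (uminus A p)
  then obtain B r where "word_act s t B r" "A ** B = mat 1" "p \<circ> r = id" by blast
  then show ?case
    using word_act.uminus[of s t B r] by (metis matrix_mult_uminus minus_minus)
next
  case (S A p)
  then obtain B r where *: "word_act s t B r" "A ** B = mat 1" "p \<circ> r = id" by blast
  have "word_act s t (- (mat 1 ** mat_S ** B)) (r \<circ> (s \<circ> id))"
    by (intro word_act.uminus word_act_mult word_act.S word_act.one *)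
  moreover have "(A ** mat_S) ** - (mat 1 ** mat_S ** B) = mat 1"
    using * by (simp add: matrix_mult_uminus matrix_mul_assoc mat_S_square)
  moreover have "(s \<circ> p) \<circ> (r \<circ> (s \<circ> id)) = id"
    using s *(3) by (metis comp_assoc comp_id)
  ultimately show ?case by blast
next
  case (U A p)
  then obtain B r where *: "word_act s t B r" "A ** B = mat 1" "p \<circ> r = id" by blast
  have "word_act s t (- (mat 1 ** mat_U ** mat_U ** B)) (r \<circ> (t \<circ> (t \<circ> id)))"
    by (intro word_act.uminus word_act_mult word_act.U word_act.one *)
  moreover have "(A ** mat_U) ** - (mat 1 ** mat_U ** mat_U ** B) = mat 1"
    using * by (simp add: matrix_mult_uminus matrix_mul_assoc mat_U_cube)
  moreover have "(t \<circ> p) \<circ> (r \<circ> (t \<circ> (t \<circ> id))) = id"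
    using t *(3) by (metis comp_assoc comp_id)
  ultimately show ?case by blast
qed

text \<open>Freeness: the value of a word depends only on its matrix. For values p and q of A and
  the value r of an inverse word, both \<open>p \<circ> r\<close> and \<open>r \<circ> q\<close> are
  the identity.\<close>

lemma word_act_unique:
  assumes s: "s \<circ> s = id" and t: "t \<circ> t \<circ> t = id" and p: "word_act s t A p" and q: "word_act s t A q"
  shows "p = q"
proof -
  obtain B r where *: "word_act s t B r" "A ** B = mat 1" "p \<circ> r = id"
    using word_act_inverse[OF s t p] by blast
  have "r \<circ> q = id"
    using word_act_mult[OF q *(1)] *(2) by (intro word_act_mat_1[OF s t]) simp
  then show ?thesis using *(3) by (metis comp_assoc comp_id id_comp)
qed

lemma word_act_exists: "det A = 1 \<Longrightarrow> \<exists>p. word_act s t A p"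
  by (induction rule: SL2Z_induct) (blast intro: word_act.intros)+

section \<open>Passage to the quotient PSL_2(Z)\<close>

definition proj :: "int ^ 2 ^ 2 \<Rightarrow> (int ^ 2 ^ 2) set" where
  "proj A = {A, - A}"

lemma carrier_PSL2Z: "carrier PSL2Z = proj ` {A. det A = 1}"
  by (auto simp: PSL2Z_def SL2Z_def FactGroup_def RCOSETS_def r_coset_def proj_def
      matrix_mult_uminus image_def)

lemma mult_PSL2Z: "proj A \<otimes>\<^bsub>PSL2Z\<^esub> proj B = proj (A ** B)"
  by (auto simp: PSL2Z_def SL2Z_def FactGroup_def set_mult_def proj_def matrix_mult_uminus)

lemma one_PSL2Z: "\<one>\<^bsub>PSL2Z\<^esub> = proj (mat 1)"
  by (simp add: PSL2Z_def FactGroup_def proj_def)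

lemma proj_eq_iff: "proj A = proj B \<longleftrightarrow> A = B \<or> A = - B"
  by (auto simp: proj_def doubleton_eq_iff)

lemma PSL2Z_induct:
  assumes "g \<in> carrier PSL2Z" and "P \<one>\<^bsub>PSL2Z\<^esub>"
    and S: "\<And>g. g \<in> carrier PSL2Z \<Longrightarrow> P g \<Longrightarrow> P (g \<otimes>\<^bsub>PSL2Z\<^esub> proj mat_S)"
    and U: "\<And>g. g \<in> carrier PSL2Z \<Longrightarrow> P g \<Longrightarrow> P (g \<otimes>\<^bsub>PSL2Z\<^esub> proj mat_U)"
  shows "P g"
proof -
  obtain A where A: "g = proj A" "det A = 1" using assms(1) by (auto simp: carrier_PSL2Z)
  from A(2) have "det A = 1 \<and> P (proj A)"
  proof (induction rule: SL2Z_induct)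
    case one
    then show ?case using assms(2) by (simp add: one_PSL2Z)
  next
    case (uminus A)
    moreover have "proj (- A) = proj A" by (simp add: proj_eq_iff)
    moreover have "det (- A) = det A" by (simp add: det_2)
    ultimately show ?case by simp
  next
    case (S A)
    then show ?case using assms(3)[of "proj A"]
      by (auto simp: carrier_PSL2Z mult_PSL2Z det_mul mat_S_def)
  next
    case (U A)
    then show ?case using assms(4)[of "proj A"]
      by (auto simp: carrier_PSL2Z mult_PSL2Z det_mul mat_U_def)
  qed
  then show ?thesis by (simp add: A)
qed

text \<open>Universal property of the free product of Z/2 and Z/3: the value of a matrix is unique
  and the same for A and - A, so evaluation of words descends to the quotient.\<close>

lemma PSL2Z_act:
  fixes s t :: "'a \<Rightarrow> 'a"
  assumes s: "s \<circ> s = id" and t: "t \<circ> t \<circ> t = id"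
  shows "\<exists>act. act \<one>\<^bsub>PSL2Z\<^esub> = id \<and> (\<forall>g\<in>carrier PSL2Z.
    act (g \<otimes>\<^bsub>PSL2Z\<^esub> proj mat_S) = s \<circ> act g \<and> act (g \<otimes>\<^bsub>PSL2Z\<^esub> proj mat_U) = t \<circ> act g)"
proof -
  define act where "act g = (THE p. \<exists>A. g = proj A \<and> word_act s t A p)" for g
  have act: "act (proj A) = p" if "word_act s t A p" for A p
    unfolding act_def
  proof (rule the_equality)
    show "\<exists>B. proj A = proj B \<and> word_act s t B p" using that by blast
    fix q assume "\<exists>B. proj A = proj B \<and> word_act s t B q"
    then have "word_act s t A q" by (metis proj_eq_iff word_act.uminus minus_minus)
    then show "q = p" using that by (rule word_act_unique[OF s t])
  qed
  have "act (g \<otimes>\<^bsub>PSL2Z\<^esub> proj mat_S) = s \<circ> act g \<and> act (g \<otimes>\<^bsub>PSL2Z\<^esub> proj mat_U) = t \<circ> act g"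
    if "g \<in> carrier PSL2Z" for g
  proof -
    obtain A where A: "g = proj A" "det A = 1"
      using \<open>g \<in> carrier PSL2Z\<close> by (auto simp: carrier_PSL2Z)
    moreover obtain p where "word_act s t A p"
      using word_act_exists[OF A(2), of s t] by blast
    ultimately show ?thesis
      using act word_act.S[of s t A p] word_act.U[of s t A p] by (simp add: mult_PSL2Z)
  qed
  moreover have "act \<one>\<^bsub>PSL2Z\<^esub> = id" unfolding one_PSL2Z by (rule act[OF word_act.one])
  ultimately show ?thesis by blast
qed

section \<open>Permutations of order dividing two and three\<close>

text \<open>The numbers of permutations of n points with trivial square and, for
  \<open>cube_roots\<close>, with trivial cube; see \<open>card_perm_roots_2\<close> and
  \<open>card_perm_roots_3\<close>. The recurrences classify by the cycle of one chosen
  point.\<close>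

fun involutions :: "nat \<Rightarrow> nat" where
  "involutions 0 = 1"
| "involutions (Suc 0) = 1"
| "involutions (Suc (Suc n)) = involutions (Suc n) + (n + 1) * involutions n"

fun cube_roots :: "nat \<Rightarrow> nat" where
  "cube_roots 0 = 1"
| "cube_roots (Suc 0) = 1"
| "cube_roots (Suc (Suc 0)) = 1"
| "cube_roots (Suc (Suc (Suc n))) = cube_roots (Suc (Suc n)) + (n + 2) * (n + 1) * cube_roots n"

definition pair_egf :: "rat fps" where
  "pair_egf = Abs_fps (\<lambda>n. of_nat (involutions n * cube_roots n) / fact n)"

section \<open>Differential equation for the generating function of the pairs\<close>

lemma involutions_values:
  "involutions 2 = 2" "involutions 3 = 4" "involutions 4 = 10" "involutions 5 = 26"
  "involutions 6 = 76" "involutions 7 = 232" "involutions 8 = 764"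
proof -
  have rec: "involutions l = involutions k + k * involutions n" if "k = Suc n" "l = Suc k" for n k l
    using that by simp
  show 2: "involutions 2 = 2" using rec[of 1 0 2] by simp
  show 3: "involutions 3 = 4" using rec[of 2 1 3] 2 by simp
  show 4: "involutions 4 = 10" using rec[of 3 2 4] 2 3 by simp
  show 5: "involutions 5 = 26" using rec[of 4 3 5] 3 4 by simp
  show 6: "involutions 6 = 76" using rec[of 5 4 6] 4 5 by simp
  show 7: "involutions 7 = 232" using rec[of 6 5 7] 5 6 by simp
  show "involutions 8 = 764" using rec[of 7 6 8] 6 7 by simp
qed

lemma cube_roots_values:
  "cube_roots 2 = 1" "cube_roots 3 = 3" "cube_roots 4 = 9" "cube_roots 5 = 21"
  "cube_roots 6 = 81" "cube_roots 7 = 351" "cube_roots 8 = 1233"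
proof -
  have rec: "cube_roots l = cube_roots k + k * j * cube_roots n"
    if "j = Suc n" "k = Suc j" "l = Suc k" for n j k l
    using that by simp
  show 2: "cube_roots 2 = 1" by (simp add: numeral_2_eq_2)
  show 3: "cube_roots 3 = 3" using rec[of 1 0 2 3] 2 by simp
  show 4: "cube_roots 4 = 9" using rec[of 2 1 3 4] 2 3 by simp
  show 5: "cube_roots 5 = 21" using rec[of 3 2 4 5] 2 3 4 by simp
  show 6: "cube_roots 6 = 81" using rec[of 4 3 5 6] 3 4 5 by simp
  show 7: "cube_roots 7 = 351" using rec[of 5 4 6 7] 4 5 6 by simp
  show "cube_roots 8 = 1233" using rec[of 6 5 7 8] 5 6 7 by simp
qed

text \<open>Both counting sequences have polynomial recurrences, hence so does their product. The
  coefficient of z^n is a relation between values of h from n - 8 to n + 1, which the recurrences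
  reduce to a polynomial identity.\<close>

lemma pair_egf_ode:
  "(fps_X ^ 7 - fps_X ^ 10) * fps_deriv (fps_deriv pair_egf)
   + (- 1 + 4 * fps_X ^ 3 + 2 * fps_X ^ 4 + 4 * fps_X ^ 6 - 2 * fps_X ^ 7 - 4 * fps_X ^ 9) * fps_deriv pair_egf
   + (1 + fps_X + 4 * fps_X ^ 2 + 4 * fps_X ^ 3 - fps_X ^ 4 + 4 * fps_X ^ 5 - 2 * fps_X ^ 6 - 2 * fps_X ^ 8)
     * pair_egf = 0"
  (is "?E = 0")
proof (rule fps_ext)
  fix n
  define h where "h = fps_nth pair_egf"
  have numeral_nth: "fps_nth (numeral k * f) m = numeral k * fps_nth f m" for k m and f :: "rat fps"
    by (simp add: fps_numeral_fps_const)
  have E: "?E = fps_X ^ 7 * fps_deriv (fps_deriv pair_egf) - fps_X ^ 10 * fps_deriv (fps_deriv pair_egf)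
     - fps_deriv pair_egf + 4 * (fps_X ^ 3 * fps_deriv pair_egf) + 2 * (fps_X ^ 4 * fps_deriv pair_egf)
     + 4 * (fps_X ^ 6 * fps_deriv pair_egf) - 2 * (fps_X ^ 7 * fps_deriv pair_egf)
     - 4 * (fps_X ^ 9 * fps_deriv pair_egf) + pair_egf + fps_X ^ 1 * pair_egf
     + 4 * (fps_X ^ 2 * pair_egf) + 4 * (fps_X ^ 3 * pair_egf) - fps_X ^ 4 * pair_egf
     + 4 * (fps_X ^ 5 * pair_egf) - 2 * (fps_X ^ 6 * pair_egf) - 2 * (fps_X ^ 8 * pair_egf)"
    by (simp add: algebra_simps)
  have coeff: "fps_nth ?E n =
      (if n < 7 then 0 else of_nat (n - 7 + 1) * (of_nat (n - 7 + 1 + 1) * h (n - 7 + 1 + 1)))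
    - (if n < 10 then 0 else of_nat (n - 10 + 1) * (of_nat (n - 10 + 1 + 1) * h (n - 10 + 1 + 1)))
    - of_nat (n + 1) * h (n + 1)
    + 4 * (if n < 3 then 0 else of_nat (n - 3 + 1) * h (n - 3 + 1))
    + 2 * (if n < 4 then 0 else of_nat (n - 4 + 1) * h (n - 4 + 1))
    + 4 * (if n < 6 then 0 else of_nat (n - 6 + 1) * h (n - 6 + 1))
    - 2 * (if n < 7 then 0 else of_nat (n - 7 + 1) * h (n - 7 + 1))
    - 4 * (if n < 9 then 0 else of_nat (n - 9 + 1) * h (n - 9 + 1))
    + h n + (if n < 1 then 0 else h (n - 1)) + 4 * (if n < 2 then 0 else h (n - 2))
    + 4 * (if n < 3 then 0 else h (n - 3)) - (if n < 4 then 0 else h (n - 4))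
    + 4 * (if n < 5 then 0 else h (n - 5)) - 2 * (if n < 6 then 0 else h (n - 6))
    - 2 * (if n < 8 then 0 else h (n - 8))"
    unfolding E
    unfolding fps_add_nth fps_sub_nth numeral_nth fps_X_power_mult_nth fps_deriv_nth h_def[symmetric] ..
  have h: "h k = of_nat (involutions k * cube_roots k) / fact k" for k
    by (simp add: h_def pair_egf_def)
  have h_init: "h 0 = 1" "h 1 = 1" "h 2 = 1" "h 3 = 2" "h 4 = 15 / 4" "h 5 = 91 / 20" "h 6 = 171 / 20"
    "h 7 = 1131 / 70" "h 8 = 26167 / 1120"
    unfolding h using involutions_values cube_roots_values by (simp_all add: fact_numeral)
  show "fps_nth ?E n = fps_nth 0 n"
  \<comment> \<open>For small n some shifted terms are cut off, so these coefficients are checked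
    numerically.\<close>
  proof (cases "n < 8")
    case True
    then consider "n = 0" | "n = 1" | "n = 2" | "n = 3" | "n = 4" | "n = 5" | "n = 6" | "n = 7"
      by linarith
    then show ?thesis
      unfolding coeff by cases (simp_all add: h_init h_init(2)[simplified] h_init(3)[unfolded numeral_2_eq_2])
  next
    case False
    then obtain m where n: "n = m + 8" by (metis add.commute le_Suc_ex not_less)
    define x :: rat where "x = of_nat m"
    define a :: "nat \<Rightarrow> rat" where "a = (\<lambda>j. of_nat (involutions (m + j)))"
    define b :: "nat \<Rightarrow> rat" where "b = (\<lambda>j. of_nat (cube_roots (m + j)))"
    define g :: "nat \<Rightarrow> rat" where "g = (\<lambda>j. 1 / fact (m + j))"
    have a_rec: "a (Suc (Suc j)) = a (Suc j) + (x + of_nat j + 1) * a j" for j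
      by (simp add: a_def x_def algebra_simps)
    have b_rec: "b (Suc (Suc (Suc j))) = b (Suc (Suc j)) + (x + of_nat j + 2) * (x + of_nat j + 1) * b j" for j
      by (simp add: b_def x_def algebra_simps)
    have a: "a 2 = a 1 + (x + 1) * a 0" "a 3 = a 2 + (x + 2) * a 1" "a 4 = a 3 + (x + 3) * a 2"
      "a 5 = a 4 + (x + 4) * a 3" "a 6 = a 5 + (x + 5) * a 4" "a 7 = a 6 + (x + 6) * a 5"
      "a 8 = a 7 + (x + 7) * a 6" "a 9 = a 8 + (x + 8) * a 7"
      using a_rec[of 0] a_rec[of 1] a_rec[of 2] a_rec[of 3] a_rec[of 4] a_rec[of 5] a_rec[of 6] a_rec[of 7]
      by (simp_all add: eval_nat_numeral algebra_simps)
    have b: "b 3 = b 2 + (x + 2) * (x + 1) * b 0" "b 4 = b 3 + (x + 3) * (x + 2) * b 1"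
      "b 5 = b 4 + (x + 4) * (x + 3) * b 2" "b 6 = b 5 + (x + 5) * (x + 4) * b 3"
      "b 7 = b 6 + (x + 6) * (x + 5) * b 4" "b 8 = b 7 + (x + 7) * (x + 6) * b 5"
      "b 9 = b 8 + (x + 8) * (x + 7) * b 6"
      using b_rec[of 0] b_rec[of 1] b_rec[of 2] b_rec[of 3] b_rec[of 4] b_rec[of 5] b_rec[of 6]
      by (simp_all add: eval_nat_numeral algebra_simps)
    \<comment> \<open>All inverse factorials are expressed through \<open>g 9\<close>, so that no
      division remains: the final identity is polynomial in x, \<open>a 0\<close>,
      \<open>a 1\<close>, \<open>b 0\<close>, \<open>b 1\<close>, \<open>b 2\<close> and
      \<open>g 9\<close>.\<close>
    have g_rec: "g j = (x + of_nat j + 1) * g (Suc j)" for j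
    proof -
      define c where "c = x + of_nat j + 1"
      have "c \<noteq> 0" by (simp add: c_def x_def add_nonneg_eq_0_iff)
      moreover have "fact (m + Suc j) = c * fact (m + j)"
        by (simp add: c_def x_def algebra_simps)
      ultimately show ?thesis by (simp add: g_def c_def[symmetric])
    qed
    have g: "g 0 = (x + 1) * g 1" "g 1 = (x + 2) * g 2" "g 2 = (x + 3) * g 3" "g 3 = (x + 4) * g 4"
      "g 4 = (x + 5) * g 5" "g 5 = (x + 6) * g 6" "g 6 = (x + 7) * g 7" "g 7 = (x + 8) * g 8"
      "g 8 = (x + 9) * g 9"
      using g_rec[of 0] g_rec[of 1] g_rec[of 2] g_rec[of 3] g_rec[of 4] g_rec[of 5] g_rec[of 6]
        g_rec[of 7] g_rec[of 8]
      by (simp_all add: eval_nat_numeral algebra_simps)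
    have hm: "h (m + j) = a j * b j * g j" for j
      by (simp add: h a_def b_def g_def)
    have h0: "h m = a 0 * b 0 * g 0" using hm[of 0] by simp
    have h1: "h (Suc m) = a 1 * b 1 * g 1" using hm[of 1] by simp
    have h3: "h (Suc (Suc (Suc m))) = a 3 * b 3 * g 3"
      using hm[of 3] by (simp add: numeral_3_eq_3)
    \<comment> \<open>At n = 8, and for \<open>t10\<close> also at n = 9, the conditional gives 0;
      there the factor x, respectively x (x - 1), vanishes as well, so one formula serves all n >=
      8.\<close>
    have t9: "(if n < 9 then 0 else of_nat (n - 9 + 1) * h (n - 9 + 1)) = x * (a 0 * b 0 * g 0)"
      unfolding h0[symmetric] by (cases m) (auto simp: n x_def)
    have t10: "(if n < 10 then 0 else of_nat (n - 10 + 1) * (of_nat (n - 10 + 1 + 1) * h (n - 10 + 1 + 1)))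
      = (x - 1) * (x * (a 0 * b 0 * g 0))"
    proof -
      consider "m = 0" | "m = 1" | k where "m = k + 2"
        by (metis One_nat_def Suc_eq_plus1 add_2_eq_Suc' not0_implies_Suc)
      then show ?thesis
        unfolding h0[symmetric] by cases (auto simp: n x_def)
    qed
    have "fps_nth ?E n = (x + 2) * ((x + 3) * (a 3 * b 3 * g 3)) - (x - 1) * (x * (a 0 * b 0 * g 0))
      - (x + 9) * (a 9 * b 9 * g 9) + 4 * ((x + 6) * (a 6 * b 6 * g 6))
      + 2 * ((x + 5) * (a 5 * b 5 * g 5)) + 4 * ((x + 3) * (a 3 * b 3 * g 3))
      - 2 * ((x + 2) * (a 2 * b 2 * g 2)) - 4 * (x * (a 0 * b 0 * g 0))
      + a 8 * b 8 * g 8 + a 7 * b 7 * g 7 + 4 * (a 6 * b 6 * g 6) + 4 * (a 5 * b 5 * g 5)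
      - a 4 * b 4 * g 4 + 4 * (a 3 * b 3 * g 3) - 2 * (a 2 * b 2 * g 2) - 2 * (a 0 * b 0 * g 0)"
      unfolding coeff t9 t10
      using hm[of 2] hm[of 3] hm[of 4] hm[of 5] hm[of 6] hm[of 7] hm[of 8] hm[of 9]
      by (simp add: n x_def h0 h3 add.commute)
    also have "\<dots> = 0"
      unfolding g unfolding a b by algebra
    finally show ?thesis by simp
  qed
qed

section \<open>Counting permutations whose square or cube is trivial\<close>

lemma funpow_cong_on:
  assumes "\<And>x. x \<in> B \<Longrightarrow> f x = g x \<and> g x \<in> B" and "x \<in> B"
  shows "(f ^^ k) x = (g ^^ k) x \<and> (g ^^ k) x \<in> B"
  using assms by (induction k) auto

definition perm_roots :: "nat \<Rightarrow> 'a set \<Rightarrow> ('a \<Rightarrow> 'a) set" where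
  "perm_roots m X = {p. p permutes X \<and> p ^^ m = id}"

lemma finite_perm_roots: "finite X \<Longrightarrow> finite (perm_roots m X)"
  unfolding perm_roots_def by (rule finite_subset[OF _ finite_permutations]) auto

text \<open>Since c is onto A and p is injective, a permutation p that agrees with c on A sends no
  other point into A. It is therefore c glued to a root on the complement, and every such gluing
  occurs.\<close>

lemma card_perm_roots_extending:
  assumes X: "finite X" "A \<subseteq> X" and c: "c permutes A" "c ^^ m = id"
  shows "card {p \<in> perm_roots m X. \<forall>a\<in>A. p a = c a} = card (perm_roots m (X - A))"
proof -
  define merge where "merge r x = (if x \<in> A then c x else r x)" for r x
  define restr where "restr p x = (if x \<in> A then x else p x)" for p and x :: 'a
  have "bij_betw merge (perm_roots m (X - A)) {p \<in> perm_roots m X. \<forall>a\<in>A. p a = c a}"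
  proof (rule bij_betw_byWitness[of _ restr])
    show "\<forall>r\<in>perm_roots m (X - A). restr (merge r) = r"
      by (auto simp: perm_roots_def restr_def merge_def fun_eq_iff permutes_not_in)
    show "\<forall>p\<in>{p \<in> perm_roots m X. \<forall>a\<in>A. p a = c a}. merge (restr p) = p"
      by (auto simp: merge_def restr_def fun_eq_iff)
    show "merge ` perm_roots m (X - A) \<subseteq> {p \<in> perm_roots m X. \<forall>a\<in>A. p a = c a}"
    proof
      fix p assume "p \<in> merge ` perm_roots m (X - A)"
      then obtain r where p: "p = merge r" and r: "r permutes X - A" "r ^^ m = id"
        by (auto simp: perm_roots_def)
      have rA: "r x \<notin> A" if "x \<notin> A" for x
        using r(1) that by (metis Diff_iff permutes_in_image permutes_not_in)
      have "merge r = c \<circ> r"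
      proof
        fix x show "merge r x = (c \<circ> r) x"
          using rA[of x] permutes_not_in[OF c(1), of "r x"] permutes_not_in[OF r(1), of x]
          by (auto simp: merge_def)
      qed
      moreover have "c \<circ> r permutes X"
        using X(2) by (intro permutes_compose permutes_subset[OF c(1)] permutes_subset[OF r(1)]) auto
      ultimately have "p permutes X" by (simp add: p)
      moreover have "p ^^ m = id"
      proof
        fix x show "(p ^^ m) x = id x"
        proof (cases "x \<in> A")
          case True
          then have "(p ^^ m) x = (c ^^ m) x"
            using funpow_cong_on[of A p c x m] permutes_in_image[OF c(1)] by (simp add: p merge_def)
          then show ?thesis by (simp add: c)
        next
          case False
          then have "(p ^^ m) x = (r ^^ m) x"
            using funpow_cong_on[of "- A" p r x m] rA by (simp add: p merge_def)
          then show ?thesis by (simp add: r)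
        qed
      qed
      ultimately show "p \<in> {p \<in> perm_roots m X. \<forall>a\<in>A. p a = c a}"
        by (simp add: perm_roots_def p merge_def)
    qed
    show "restr ` {p \<in> perm_roots m X. \<forall>a\<in>A. p a = c a} \<subseteq> perm_roots m (X - A)"
    proof
      fix r assume "r \<in> restr ` {p \<in> perm_roots m X. \<forall>a\<in>A. p a = c a}"
      then obtain p where r: "r = restr p" and p: "p permutes X" "p ^^ m = id" "\<forall>a\<in>A. p a = c a"
        by (auto simp: perm_roots_def)
      have pA: "p x \<notin> A" if "x \<notin> A" for x
      proof
        assume "p x \<in> A"
        then obtain a where "a \<in> A" "c a = p x"
          using c(1) by (metis permutes_image imageE)
        then have "p a = p x" using p(3) by simp
        then have "a = x" using p(1) by (metis permutes_inj injD)
        then show False using that \<open>a \<in> A\<close> by simp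
      qed
      have "restr p = inv_into UNIV c \<circ> p"
      proof
        fix x show "restr p x = (inv_into UNIV c \<circ> p) x"
          using pA[of x] permutes_not_in[OF permutes_inv[OF c(1)], of "p x"] p(3)
            permutes_inverses(2)[OF c(1), of x]
          by (auto simp: restr_def)
      qed
      moreover have "inv_into UNIV c \<circ> p permutes X"
        using X(2) by (intro permutes_compose p(1) permutes_subset[OF permutes_inv[OF c(1)]])
      ultimately have "r permutes X" by (simp add: r)
      then have "r permutes X - A"
        by (rule permutes_superset) (auto simp: r restr_def)
      moreover have "r ^^ m = id"
      proof
        fix x show "(r ^^ m) x = id x"
        proof (cases "x \<in> A")
          case True
          then have "(r ^^ m) x = (id ^^ m) x"
            using funpow_cong_on[of A r id x m] by (simp add: r restr_def)
          then show ?thesis by simp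
        next
          case False
          then have "(r ^^ m) x = (p ^^ m) x"
            using funpow_cong_on[of "- A" r p x m] pA by (simp add: r restr_def)
          then show ?thesis by (simp add: p)
        qed
      qed
      ultimately show "r \<in> perm_roots m (X - A)" by (simp add: perm_roots_def)
    qed
  qed
  from bij_betw_same_card[OF this] show ?thesis by (rule sym)
qed

lemma card_perm_roots_2: "finite X \<Longrightarrow> card (perm_roots 2 X) = involutions (card X)"
proof (induction "card X" arbitrary: X rule: less_induct)
  case less
  show ?case
  proof (cases "X = {}")
    case True
    then have "perm_roots 2 X = {id}" by (auto simp: perm_roots_def)
    then show ?thesis using True by simp
  next
    case False
    then obtain x where x: "x \<in> X" by blast
    \<comment> \<open>For y = x the transposition is the identity, so the family also covers the
      case that x is fixed.\<close>
    define F where "F y = {p \<in> perm_roots 2 X. \<forall>a\<in>{x, y}. p a = Transposition.transpose x y a}" for y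
    have F: "card (F y) = involutions (card (X - {x, y}))" if "y \<in> X" for y
    proof -
      have "card (F y) = card (perm_roots 2 (X - {x, y}))"
        unfolding F_def
        by (rule card_perm_roots_extending) (use that x less.prems in \<open>auto simp: permutes_swap_id numeral_2_eq_2\<close>)
      also have "\<dots> = involutions (card (X - {x, y}))"
        using x less.prems by (intro less.hyps psubset_card_mono) auto
      finally show ?thesis .
    qed
    have mem: "p x \<in> X \<and> p \<in> F (p x)" if "p \<in> perm_roots 2 X" for p
    proof -
      have "p (p x) = x" using that by (simp add: perm_roots_def fun_eq_iff numeral_2_eq_2)
      then show ?thesis
        using that x by (auto simp: F_def perm_roots_def permutes_in_image)
    qed
    have "perm_roots 2 X = (\<Union>y\<in>X. F y)"
      using mem by (auto simp: F_def)
    also have "card \<dots> = (\<Sum>y\<in>X. card (F y))"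
      using less.prems finite_perm_roots[of X 2] by (intro card_UN_disjoint) (auto simp: F_def)
    also have "\<dots> = (\<Sum>y\<in>X. involutions (card (X - {x, y})))"
      by (rule sum.cong[OF refl F])
    also have "\<dots> = involutions (card (X - {x})) + (\<Sum>y\<in>X - {x}. involutions (card (X - {x, y})))"
      using x less.prems by (subst sum.remove[of X x]) auto
    also have "(\<Sum>y\<in>X - {x}. involutions (card (X - {x, y}))) = (\<Sum>y\<in>X - {x}. involutions (card X - 2))"
      using x less.prems by (intro sum.cong) (auto simp: card_Diff_subset numeral_2_eq_2)
    finally have *: "card (perm_roots 2 X) = involutions (card X - 1) + (card X - 1) * involutions (card X - 2)"
      using x less.prems by simp
    show ?thesis
    proof (cases "card X = 1")
      case False
      moreover have "card X \<noteq> 0" using x less.prems by auto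
      ultimately obtain k where "card X = Suc (Suc k)" by (metis One_nat_def not0_implies_Suc)
      then show ?thesis using * by simp
    qed (use * in simp)
  qed
qed

lemma card_perm_roots_3: "finite X \<Longrightarrow> card (perm_roots 3 X) = cube_roots (card X)"
proof (induction "card X" arbitrary: X rule: less_induct)
  case less
  show ?case
  proof (cases "X = {}")
    case True
    then have "perm_roots 3 X = {id}" by (auto simp: perm_roots_def)
    then show ?thesis using True by simp
  next
    case False
    then obtain x where x: "x \<in> X" by blast
    define n where "n = card X"
    have cube: "p (p (p a)) = a" if "p \<in> perm_roots 3 X" for p and a :: 'a
      using that by (simp add: perm_roots_def fun_eq_iff numeral_3_eq_3)
    define F0 where "F0 = {p \<in> perm_roots 3 X. \<forall>a\<in>{x}. p a = id a}"
    have F0: "card F0 = cube_roots (n - 1)"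
    proof -
      have "card F0 = card (perm_roots 3 (X - {x}))"
        unfolding F0_def
        by (rule card_perm_roots_extending) (use x less.prems in \<open>auto simp: permutes_id numeral_3_eq_3 fun_eq_iff\<close>)
      also have "\<dots> = cube_roots (card (X - {x}))"
        using x less.prems by (intro less.hyps psubset_card_mono) auto
      finally show ?thesis using x less.prems by (simp add: n_def)
    qed
    \<comment> \<open>The cycle x to y to z to x. A point x that is not fixed lies on exactly one
      such cycle, given by y = p x and z = p (p x).\<close>
    define c where "c y z = Transposition.transpose x y \<circ> Transposition.transpose y z" for y z
    define F where "F = (\<lambda>(y, z). {p \<in> perm_roots 3 X. \<forall>a\<in>{x, y, z}. p a = c y z a})"
    define P where "P = Sigma (X - {x}) (\<lambda>y. X - {x, y})"
    have c: "c y z x = y" "c y z y = z" "c y z z = x" if "x \<noteq> y" "x \<noteq> z" "y \<noteq> z" for y z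
      using that by (auto simp: c_def Transposition.transpose_def)
    have F: "card (F q) = cube_roots (n - 3)" if "q \<in> P" for q
    proof -
      obtain y z where q: "q = (y, z)" by (cases q)
      have yz: "y \<in> X" "z \<in> X" "x \<noteq> y" "x \<noteq> z" "y \<noteq> z" using that by (auto simp: q P_def)
      have "c y z ^^ 3 = id"
      proof
        fix a show "(c y z ^^ 3) a = id a"
          using yz by (auto simp: c_def Transposition.transpose_def numeral_3_eq_3)
      qed
      moreover have "c y z permutes {x, y, z}"
        unfolding c_def by (intro permutes_compose permutes_swap_id) auto
      ultimately have "card (F q) = card (perm_roots 3 (X - {x, y, z}))"
        unfolding F_def q prod.case
        by (intro card_perm_roots_extending) (use x yz less.prems in auto)
      also have "\<dots> = cube_roots (card (X - {x, y, z}))"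
        using x less.prems by (intro less.hyps psubset_card_mono) auto
      also have "card (X - {x, y, z}) = n - 3"
        using x yz less.prems by (subst card_Diff_subset) (auto simp: n_def)
      finally show ?thesis .
    qed
    have mem: "p \<in> F0 \<or> ((p x, p (p x)) \<in> P \<and> p \<in> F (p x, p (p x)))" if p: "p \<in> perm_roots 3 X" for p
    proof (cases "p x = x")
      case True
      then show ?thesis using p by (auto simp: F0_def)
    next
      case False
      have inj: "p a = p b \<longleftrightarrow> a = b" for a b
        using cube[OF p] by metis
      have "p (p x) \<noteq> p x" "p (p x) \<noteq> x"
        using False inj cube[OF p, of x] by metis+
      moreover have "p x \<in> X" "p (p x) \<in> X"
        using p x by (auto simp: perm_roots_def permutes_in_image)
      ultimately show ?thesis
        using p False c[of "p x" "p (p x)"] cube[OF p, of x] by (auto simp: P_def F_def)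
    qed
    have val: "(p x, p (p x)) = q" if "p \<in> F q" "q \<in> P" for p q
      using that c by (auto simp: F_def P_def)
    have val0: "(p x, p (p x)) \<notin> P" if "p \<in> F0" for p
      using that by (auto simp: F0_def P_def)
    have fin: "finite P" using less.prems by (auto simp: P_def)
    have finF: "finite (F q)" "finite F0" for q
      using finite_perm_roots[OF less.prems, of 3] by (auto simp: F_def F0_def split: prod.split)
    have "perm_roots 3 X = F0 \<union> (\<Union>q\<in>P. F q)"
      using mem by (auto simp: F0_def F_def)
    also have "card \<dots> = card F0 + card (\<Union>q\<in>P. F q)"
      using val val0 fin finF by (intro card_Un_disjoint) auto
    also have "card (\<Union>q\<in>P. F q) = (\<Sum>q\<in>P. card (F q))"
    proof (intro card_UN_disjoint ballI impI)
      fix q r assume "q \<in> P" "r \<in> P" "q \<noteq> r"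
      then show "F q \<inter> F r = {}" using val by (metis disjoint_iff)
    qed (use fin finF in auto)
    also have "\<dots> = card P * cube_roots (n - 3)"
      using F by simp
    also have "card P = (\<Sum>y\<in>X - {x}. card (X - {x, y}))"
      unfolding P_def using less.prems by (intro card_SigmaI) auto
    also have "\<dots> = (\<Sum>y\<in>X - {x}. n - 2)"
      using x less.prems by (intro sum.cong) (auto simp: n_def card_Diff_subset numeral_2_eq_2)
    finally have *: "card (perm_roots 3 X) = cube_roots (n - 1) + (n - 1) * (n - 2) * cube_roots (n - 3)"
      using x less.prems by (simp add: F0 n_def)
    have "n \<noteq> 0" using x less.prems by (auto simp: n_def)
    then consider "n = 1" | "n = 2" | k where "n = Suc (Suc (Suc k))"
      by (metis One_nat_def not0_implies_Suc numeral_2_eq_2)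
    then show ?thesis
      unfolding n_def[symmetric] * by cases (auto simp: numeral_2_eq_2)
  qed
qed

section \<open>Counting subgroups by permutation representations\<close>

interpretation PSL2Z: group PSL2Z by (rule group_PSL2Z)

definition gen_S :: "(int ^ 2 ^ 2) set" where "gen_S = proj mat_S"
definition gen_U :: "(int ^ 2 ^ 2) set" where "gen_U = proj mat_U"

lemma gen_in_carrier [simp]: "gen_S \<in> carrier PSL2Z" "gen_U \<in> carrier PSL2Z"
  by (auto simp: gen_S_def gen_U_def carrier_PSL2Z mat_S_def mat_U_def)

lemma gen_S_square: "gen_S \<otimes>\<^bsub>PSL2Z\<^esub> gen_S = \<one>\<^bsub>PSL2Z\<^esub>"
  by (simp add: gen_S_def mult_PSL2Z one_PSL2Z proj_eq_iff mat_S_def mat_1_eq_mat22)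

lemma gen_U_cube: "gen_U \<otimes>\<^bsub>PSL2Z\<^esub> gen_U \<otimes>\<^bsub>PSL2Z\<^esub> gen_U = \<one>\<^bsub>PSL2Z\<^esub>"
  by (simp add: gen_U_def mult_PSL2Z one_PSL2Z proj_eq_iff mat_U_def mat_1_eq_mat22)

text \<open>The action is on the right: the product \<open>g h\<close> acts by \<open>g\<close> first. In this way it matches
  right multiplication on right cosets.\<close>

definition perm_act :: "('a \<Rightarrow> 'a) \<Rightarrow> ('a \<Rightarrow> 'a) \<Rightarrow> (int ^ 2 ^ 2) set \<Rightarrow> 'a \<Rightarrow> 'a" where
  "perm_act s t = (SOME act. act \<one>\<^bsub>PSL2Z\<^esub> = id \<and> (\<forall>g\<in>carrier PSL2Z.
     act (g \<otimes>\<^bsub>PSL2Z\<^esub> gen_S) = s \<circ> act g \<and> act (g \<otimes>\<^bsub>PSL2Z\<^esub> gen_U) = t \<circ> act g))"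

lemma perm_act:
  assumes "s ^^ 2 = id" and "t ^^ 3 = id"
  shows "perm_act s t \<one>\<^bsub>PSL2Z\<^esub> = id"
    and "g \<in> carrier PSL2Z \<Longrightarrow> perm_act s t (g \<otimes>\<^bsub>PSL2Z\<^esub> gen_S) = s \<circ> perm_act s t g"
    and "g \<in> carrier PSL2Z \<Longrightarrow> perm_act s t (g \<otimes>\<^bsub>PSL2Z\<^esub> gen_U) = t \<circ> perm_act s t g"
proof -
  have "s \<circ> s = id" "t \<circ> t \<circ> t = id"
    using assms by (simp_all add: numeral_2_eq_2 numeral_3_eq_3 comp_assoc)
  from someI_ex[OF PSL2Z_act[OF this]]
  have "perm_act s t \<one>\<^bsub>PSL2Z\<^esub> = id \<and> (\<forall>g\<in>carrier PSL2Z.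
     perm_act s t (g \<otimes>\<^bsub>PSL2Z\<^esub> gen_S) = s \<circ> perm_act s t g \<and>
     perm_act s t (g \<otimes>\<^bsub>PSL2Z\<^esub> gen_U) = t \<circ> perm_act s t g)"
    unfolding perm_act_def gen_S_def gen_U_def .
  then show "perm_act s t \<one>\<^bsub>PSL2Z\<^esub> = id"
    and "g \<in> carrier PSL2Z \<Longrightarrow> perm_act s t (g \<otimes>\<^bsub>PSL2Z\<^esub> gen_S) = s \<circ> perm_act s t g"
    and "g \<in> carrier PSL2Z \<Longrightarrow> perm_act s t (g \<otimes>\<^bsub>PSL2Z\<^esub> gen_U) = t \<circ> perm_act s t g"
    by blast+
qed

lemma PSL2Z_gen_induct [consumes 1, case_names one S U]:
  assumes "g \<in> carrier PSL2Z" and "P \<one>\<^bsub>PSL2Z\<^esub>"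
    and "\<And>g. g \<in> carrier PSL2Z \<Longrightarrow> P g \<Longrightarrow> P (g \<otimes>\<^bsub>PSL2Z\<^esub> gen_S)"
    and "\<And>g. g \<in> carrier PSL2Z \<Longrightarrow> P g \<Longrightarrow> P (g \<otimes>\<^bsub>PSL2Z\<^esub> gen_U)"
  shows "P g"
  using assms unfolding gen_S_def gen_U_def by (rule PSL2Z_induct)

definition stab :: "('a \<Rightarrow> 'a) \<Rightarrow> ('a \<Rightarrow> 'a) \<Rightarrow> 'a \<Rightarrow> (int ^ 2 ^ 2) set set" where
  "stab s t z = {g \<in> carrier PSL2Z. perm_act s t g z = z}"

text \<open>An injective equivariant map identifies the space of right cosets of H with an orbit of
  the pair (s, t).\<close>

definition equivariant ::
    "('a \<Rightarrow> 'a) \<Rightarrow> ('a \<Rightarrow> 'a) \<Rightarrow> (int ^ 2 ^ 2) set set \<Rightarrow> ((int ^ 2 ^ 2) set set \<Rightarrow> 'a) \<Rightarrow> bool" where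
  "equivariant s t H f \<longleftrightarrow> (\<forall>C\<in>rcosets\<^bsub>PSL2Z\<^esub> H.
     s (f C) = f (C #>\<^bsub>PSL2Z\<^esub> gen_S) \<and> t (f C) = f (C #>\<^bsub>PSL2Z\<^esub> gen_U))"

text \<open>The maps are extensional, so that they are determined by their values on the cosets and
  can be counted.\<close>

definition coset_embeddings ::
    "(int ^ 2 ^ 2) set set \<Rightarrow> 'a set \<Rightarrow> 'a \<Rightarrow> ((int ^ 2 ^ 2) set set \<Rightarrow> 'a) set" where
  "coset_embeddings H X z = {f \<in> rcosets\<^bsub>PSL2Z\<^esub> H \<rightarrow>\<^sub>E X. inj_on f (rcosets\<^bsub>PSL2Z\<^esub> H) \<and> f H = z}"

lemma rcoset_mult:
  assumes "subgroup H PSL2Z" "g \<in> carrier PSL2Z" "h \<in> carrier PSL2Z"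
  shows "H #>\<^bsub>PSL2Z\<^esub> g #>\<^bsub>PSL2Z\<^esub> h = H #>\<^bsub>PSL2Z\<^esub> (g \<otimes>\<^bsub>PSL2Z\<^esub> h)"
  using assms by (simp add: PSL2Z.coset_mult_assoc subgroup.subset)

context
  fixes s t :: "'a \<Rightarrow> 'a"
  assumes s: "s ^^ 2 = id" and t: "t ^^ 3 = id"
begin

lemma perm_act_mult:
  assumes "g \<in> carrier PSL2Z" and "h \<in> carrier PSL2Z"
  shows "perm_act s t (g \<otimes>\<^bsub>PSL2Z\<^esub> h) z = perm_act s t h (perm_act s t g z)"
  using assms(2)
proof (induction rule: PSL2Z_gen_induct)
  case one
  then show ?case using assms(1) by (simp add: perm_act(1)[OF s t])
next
  case (S h)
  then show ?case
    using assms(1) perm_act(2)[OF s t, of h] perm_act(2)[OF s t, of "g \<otimes>\<^bsub>PSL2Z\<^esub> h"]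
    by (simp add: PSL2Z.m_assoc)
next
  case (U h)
  then show ?case
    using assms(1) perm_act(3)[OF s t, of h] perm_act(3)[OF s t, of "g \<otimes>\<^bsub>PSL2Z\<^esub> h"]
    by (simp add: PSL2Z.m_assoc)
qed

lemma perm_act_inv:
  assumes "g \<in> carrier PSL2Z"
  shows "perm_act s t (inv\<^bsub>PSL2Z\<^esub> g) (perm_act s t g z) = z"
    and "perm_act s t g (perm_act s t (inv\<^bsub>PSL2Z\<^esub> g) z) = z"
  using assms perm_act_mult[of g "inv\<^bsub>PSL2Z\<^esub> g" z] perm_act_mult[of "inv\<^bsub>PSL2Z\<^esub> g" g z]
  by (simp_all add: perm_act(1)[OF s t])

lemma subgroup_stab: "subgroup (stab s t z) PSL2Z"
proof (rule PSL2Z.subgroupI)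
  show "stab s t z \<noteq> {}" using perm_act(1)[OF s t] by (auto simp: stab_def)
  show "inv\<^bsub>PSL2Z\<^esub> g \<in> stab s t z" if "g \<in> stab s t z" for g
    using that perm_act_inv(1)[of g z] by (auto simp: stab_def)
qed (auto simp: stab_def perm_act_mult)

lemma stab_coset_eq_iff:
  assumes g: "g \<in> carrier PSL2Z" and h: "h \<in> carrier PSL2Z"
  shows "stab s t z #>\<^bsub>PSL2Z\<^esub> g = stab s t z #>\<^bsub>PSL2Z\<^esub> h \<longleftrightarrow> perm_act s t g z = perm_act s t h z"
proof
  assume "stab s t z #>\<^bsub>PSL2Z\<^esub> g = stab s t z #>\<^bsub>PSL2Z\<^esub> h"
  then have "g \<in> stab s t z #>\<^bsub>PSL2Z\<^esub> h" using PSL2Z.rcos_self[OF g subgroup_stab[of z]] by simp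
  then obtain k where "k \<in> stab s t z" "g = k \<otimes>\<^bsub>PSL2Z\<^esub> h" by (auto simp: r_coset_def)
  then show "perm_act s t g z = perm_act s t h z" using h by (simp add: stab_def perm_act_mult)
next
  assume eq: "perm_act s t g z = perm_act s t h z"
  have "g \<otimes>\<^bsub>PSL2Z\<^esub> inv\<^bsub>PSL2Z\<^esub> h \<in> stab s t z"
    using g h eq perm_act_inv(1)[OF h, of z] by (simp add: stab_def perm_act_mult)
  moreover have "g = (g \<otimes>\<^bsub>PSL2Z\<^esub> inv\<^bsub>PSL2Z\<^esub> h) \<otimes>\<^bsub>PSL2Z\<^esub> h"
    using g h by (simp add: PSL2Z.m_assoc)
  ultimately have "g \<in> stab s t z #>\<^bsub>PSL2Z\<^esub> h" unfolding r_coset_def by blast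
  then show "stab s t z #>\<^bsub>PSL2Z\<^esub> g = stab s t z #>\<^bsub>PSL2Z\<^esub> h"
    using PSL2Z.repr_independence[OF _ h subgroup_stab[of z]] by simp
qed

lemma perm_act_in:
  assumes "s permutes X" "t permutes X" "z \<in> X" "g \<in> carrier PSL2Z"
  shows "perm_act s t g z \<in> X"
  using assms(4)
  by (induction rule: PSL2Z_gen_induct)
    (use assms(1-3) in \<open>auto simp: perm_act[OF s t] permutes_in_image\<close>)

lemma equivariant_act:
  assumes H: "subgroup H PSL2Z" and eq: "equivariant s t H f" and g: "g \<in> carrier PSL2Z"
  shows "f (H #>\<^bsub>PSL2Z\<^esub> g) = perm_act s t g (f H)"
  using g
proof (induction rule: PSL2Z_gen_induct)
  case one
  then show ?case using H by (simp add: perm_act(1)[OF s t] PSL2Z.coset_mult_one subgroup.subset)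
next
  case (S g)
  have "f (H #>\<^bsub>PSL2Z\<^esub> (g \<otimes>\<^bsub>PSL2Z\<^esub> gen_S)) = s (f (H #>\<^bsub>PSL2Z\<^esub> g))"
    using eq PSL2Z.rcosetsI[OF subgroup.subset[OF H] S(1)]
    by (simp add: equivariant_def S(1) flip: rcoset_mult[OF H])
  then show ?case using S by (simp add: perm_act(2)[OF s t])
next
  case (U g)
  have "f (H #>\<^bsub>PSL2Z\<^esub> (g \<otimes>\<^bsub>PSL2Z\<^esub> gen_U)) = t (f (H #>\<^bsub>PSL2Z\<^esub> g))"
    using eq PSL2Z.rcosetsI[OF subgroup.subset[OF H] U(1)]
    by (simp add: equivariant_def U(1) flip: rcoset_mult[OF H])
  then show ?case using U by (simp add: perm_act(3)[OF s t])
qed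

text \<open>Orbit and stabiliser: if H is the stabiliser, sending H g to the image of z under g is
  well defined, injective and equivariant. Conversely, g fixes z iff f takes equal values at H g and
  H, that is, iff g lies in H. This form allows f to be chosen before s and t.\<close>

lemma stab_eq_iff_equivariant:
  assumes H: "subgroup H PSL2Z" and X: "s permutes X" "t permutes X" "z \<in> X"
  shows "stab s t z = H \<longleftrightarrow> (\<exists>f \<in> coset_embeddings H X z. equivariant s t H f)"
proof
  assume stab: "stab s t z = H"
  have coset_eq: "H #>\<^bsub>PSL2Z\<^esub> g = H #>\<^bsub>PSL2Z\<^esub> h \<longleftrightarrow> perm_act s t g z = perm_act s t h z"
    if "g \<in> carrier PSL2Z" "h \<in> carrier PSL2Z" for g h
    using stab_coset_eq_iff[OF that, of z] by (simp add: stab)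
  define f where "f = restrict (\<lambda>C. perm_act s t (SOME g. g \<in> carrier PSL2Z \<and> C = H #>\<^bsub>PSL2Z\<^esub> g) z)
      (rcosets\<^bsub>PSL2Z\<^esub> H)"
  have f: "f (H #>\<^bsub>PSL2Z\<^esub> g) = perm_act s t g z" if g: "g \<in> carrier PSL2Z" for g
  proof -
    define h where "h = (SOME h. h \<in> carrier PSL2Z \<and> H #>\<^bsub>PSL2Z\<^esub> g = H #>\<^bsub>PSL2Z\<^esub> h)"
    have "h \<in> carrier PSL2Z \<and> H #>\<^bsub>PSL2Z\<^esub> g = H #>\<^bsub>PSL2Z\<^esub> h"
      unfolding h_def by (rule someI_ex) (use g in blast)
    moreover have "f (H #>\<^bsub>PSL2Z\<^esub> g) = perm_act s t h z"
      unfolding f_def h_def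
      by (rule restrict_apply') (use PSL2Z.rcosetsI[OF subgroup.subset[OF H] g] in simp)
    ultimately show ?thesis using coset_eq g by metis
  qed
  have cosets: "\<exists>g\<in>carrier PSL2Z. C = H #>\<^bsub>PSL2Z\<^esub> g" if "C \<in> rcosets\<^bsub>PSL2Z\<^esub> H" for C
    using that by (auto simp: RCOSETS_def)
  have "f \<in> rcosets\<^bsub>PSL2Z\<^esub> H \<rightarrow>\<^sub>E X"
  proof (rule PiE_I)
    fix C assume "C \<in> rcosets\<^bsub>PSL2Z\<^esub> H"
    then show "f C \<in> X" using cosets f perm_act_in[OF X] by metis
  qed (simp add: f_def)
  moreover have "inj_on f (rcosets\<^bsub>PSL2Z\<^esub> H)"
  proof (rule inj_onI)
    fix C D assume "C \<in> rcosets\<^bsub>PSL2Z\<^esub> H" "D \<in> rcosets\<^bsub>PSL2Z\<^esub> H" "f C = f D"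
    then show "C = D" using cosets f coset_eq by metis
  qed
  moreover have "f H = z"
    using f[of "\<one>\<^bsub>PSL2Z\<^esub>"] H by (simp add: perm_act(1)[OF s t] PSL2Z.coset_mult_one subgroup.subset)
  moreover have "equivariant s t H f"
    unfolding equivariant_def
  proof
    fix C assume "C \<in> rcosets\<^bsub>PSL2Z\<^esub> H"
    then obtain g where g: "g \<in> carrier PSL2Z" "C = H #>\<^bsub>PSL2Z\<^esub> g" using cosets by blast
    then show "s (f C) = f (C #>\<^bsub>PSL2Z\<^esub> gen_S) \<and> t (f C) = f (C #>\<^bsub>PSL2Z\<^esub> gen_U)"
      by (simp add: rcoset_mult[OF H] f perm_act(2,3)[OF s t])
  qed
  ultimately show "\<exists>f \<in> coset_embeddings H X z. equivariant s t H f"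
    unfolding coset_embeddings_def by blast
next
  assume "\<exists>f \<in> coset_embeddings H X z. equivariant s t H f"
  then obtain f where f: "f \<in> coset_embeddings H X z" "equivariant s t H f" by blast
  then have z: "f H = z" and inj: "inj_on f (rcosets\<^bsub>PSL2Z\<^esub> H)" by (auto simp: coset_embeddings_def)
  have HR: "H \<in> rcosets\<^bsub>PSL2Z\<^esub> H" by (rule subgroup.subgroup_in_rcosets[OF H group_PSL2Z])
  have "perm_act s t g z = z \<longleftrightarrow> g \<in> H" if g: "g \<in> carrier PSL2Z" for g
  proof -
    have "perm_act s t g z = z \<longleftrightarrow> f (H #>\<^bsub>PSL2Z\<^esub> g) = f H"
      using equivariant_act[OF H f(2) g] by (simp add: z)
    also have "\<dots> \<longleftrightarrow> H #>\<^bsub>PSL2Z\<^esub> g = H"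
      using inj_on_eq_iff[OF inj _ HR] PSL2Z.rcosetsI[OF subgroup.subset[OF H] g] by blast
    also have "\<dots> \<longleftrightarrow> g \<in> H"
      using PSL2Z.coset_join1[OF _ g H] PSL2Z.coset_join2[OF g H] by blast
    finally show ?thesis .
  qed
  then show "stab s t z = H"
    using subgroup.subset[OF H] by (auto simp: stab_def)
qed

end

section \<open>The number of pairs with a given stabiliser\<close>

text \<open>Subtraction is truncated: if R is larger than X, the factor with
  \<open>i = card X - 1\<close> is 0, in accordance with the absence of injections.\<close>

lemma card_inj_fixing_point:
  assumes fin: "finite R" "finite X" and r: "r \<in> R" and z: "z \<in> X"
  shows "card {f \<in> R \<rightarrow>\<^sub>E X. inj_on f R \<and> f r = z} = (\<Prod>i<card R - 1. card X - 1 - i)"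
proof -
  define E where "E = {h \<in> (R - {r}) \<rightarrow>\<^sub>E (X - {z}). inj_on h (R - {r})}"
  have "bij_betw (\<lambda>h. h(r := z)) E {f \<in> R \<rightarrow>\<^sub>E X. inj_on f R \<and> f r = z}"
  proof (rule bij_betw_byWitness[of _ "\<lambda>f. f(r := undefined)"])
    show "\<forall>h\<in>E. (h(r := z))(r := undefined) = h"
      by (auto simp: E_def fun_eq_iff PiE_def extensional_def)
    show "\<forall>f\<in>{f \<in> R \<rightarrow>\<^sub>E X. inj_on f R \<and> f r = z}. (f(r := undefined))(r := z) = f"
      by auto
    show "(\<lambda>h. h(r := z)) ` E \<subseteq> {f \<in> R \<rightarrow>\<^sub>E X. inj_on f R \<and> f r = z}"
    proof
      fix f assume "f \<in> (\<lambda>h. h(r := z)) ` E"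
      then obtain h where h: "h \<in> (R - {r}) \<rightarrow>\<^sub>E (X - {z})" "inj_on h (R - {r})" and f: "f = h(r := z)"
        by (auto simp: E_def)
      have "f \<in> R \<rightarrow>\<^sub>E X" using h z r by (auto simp: f PiE_def extensional_def)
      moreover have "z \<notin> h ` (R - {r})" using h by auto
      then have "inj_on f R" using h(2) by (auto simp: f inj_on_def)
      ultimately show "f \<in> {f \<in> R \<rightarrow>\<^sub>E X. inj_on f R \<and> f r = z}" by (simp add: f)
    qed
    show "(\<lambda>f. f(r := undefined)) ` {f \<in> R \<rightarrow>\<^sub>E X. inj_on f R \<and> f r = z} \<subseteq> E"
    proof
      fix h assume "h \<in> (\<lambda>f. f(r := undefined)) ` {f \<in> R \<rightarrow>\<^sub>E X. inj_on f R \<and> f r = z}"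
      then obtain f where f: "f \<in> R \<rightarrow>\<^sub>E X" "inj_on f R" "f r = z" and h: "h = f(r := undefined)"
        by auto
      have "f x \<noteq> z" if "x \<in> R - {r}" for x
        using that f r by (metis DiffE inj_onD insertI1)
      then have "h \<in> (R - {r}) \<rightarrow>\<^sub>E (X - {z})" using f(1) by (auto simp: h PiE_def extensional_def)
      moreover have "inj_on h (R - {r})"
        unfolding h using inj_on_subset[OF f(2), of "R - {r}"] by (auto simp: inj_on_def)
      ultimately show "h \<in> E" by (simp add: E_def)
    qed
  qed
  then have "card {f \<in> R \<rightarrow>\<^sub>E X. inj_on f R \<and> f r = z} = card E"
    by (rule bij_betw_same_card[symmetric])
  also have "\<dots> = (\<Prod>i<card R - 1. card X - 1 - i)"
    unfolding E_def using fin r z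
    by (subst card_inj_on_subset_funcset) (auto simp: atLeast0LessThan)
  finally show ?thesis .
qed

lemma card_coset_embeddings:
  assumes H: "subgroup H PSL2Z" and fin: "finite (rcosets\<^bsub>PSL2Z\<^esub> H)" "finite X" and z: "z \<in> X"
  shows "card (coset_embeddings H X z) =
    (\<Prod>i<card (rcosets\<^bsub>PSL2Z\<^esub> H) - 1. card X - 1 - i)"
  unfolding coset_embeddings_def
  by (rule card_inj_fixing_point[OF fin subgroup.subgroup_in_rcosets[OF H group_PSL2Z] z])

lemma permutes_transfer:
  fixes f :: "'a \<Rightarrow> 'b"
  assumes f: "inj_on f R" and \<rho>: "\<And>C. C \<in> R \<Longrightarrow> \<rho> C \<in> R" "\<And>C. C \<in> R \<Longrightarrow> (\<rho> ^^ m) C = C" and "m > 0"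
  obtains c where "c permutes f ` R" and "c ^^ m = id" and "\<And>C. C \<in> R \<Longrightarrow> c (f C) = f (\<rho> C)"
proof
  define c where "c a = (if a \<in> f ` R then f (\<rho> (inv_into R f a)) else a)" for a
  show c: "c (f C) = f (\<rho> C)" if "C \<in> R" for C
    using that f by (simp add: c_def)
  have pow: "(c ^^ k) (f C) = f ((\<rho> ^^ k) C) \<and> (\<rho> ^^ k) C \<in> R" if "C \<in> R" for C k
    using that by (induction k) (simp_all add: c \<rho>(1))
  have pow': "(c ^^ k) a = a" if "a \<notin> f ` R" for a k
    using that by (induction k) (simp_all add: c_def)
  show m: "c ^^ m = id"
  proof
    fix a show "(c ^^ m) a = id a"
      using pow pow' \<rho>(2) by (cases "a \<in> f ` R") auto
  qed
  \<comment> \<open>From c^m = 1 and m > 0 the power c^(m-1) is a two-sided inverse of c.\<close>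
  obtain k where "m = Suc k" using \<open>m > 0\<close> by (cases m) auto
  then have "c \<circ> (c ^^ k) = id" "(c ^^ k) \<circ> c = id"
    using m by (metis funpow.simps(2), metis funpow_Suc_right)
  then have "bij c" using o_bij by blast
  then show "c permutes f ` R"
    unfolding permutes_def bij_iff by (simp add: c_def)
qed

text \<open>Equivariance prescribes s and t on the image of f, as transported right multiplications
  by the generators, and leaves them free on the remaining points.\<close>

lemma card_equivariant:
  assumes H: "subgroup H PSL2Z" and fin: "finite (rcosets\<^bsub>PSL2Z\<^esub> H)" "finite X"
    and f: "f \<in> coset_embeddings H X z"
  shows "card {(s, t) \<in> perm_roots 2 X \<times> perm_roots 3 X. equivariant s t H f} =
    involutions (card X - card (rcosets\<^bsub>PSL2Z\<^esub> H)) * cube_roots (card X - card (rcosets\<^bsub>PSL2Z\<^esub> H))"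
proof -
  define R where "R = rcosets\<^bsub>PSL2Z\<^esub> H"
  have inj: "inj_on f R" and fX: "f ` R \<subseteq> X"
    using f by (auto simp: coset_embeddings_def R_def)
  have mult: "C #>\<^bsub>PSL2Z\<^esub> g \<in> R" if "C \<in> R" "g \<in> carrier PSL2Z" for C g
    using that rcoset_mult[OF H] PSL2Z.rcosetsI[OF subgroup.subset[OF H]]
    by (auto simp: R_def RCOSETS_def)
  have S: "((\<lambda>C. C #>\<^bsub>PSL2Z\<^esub> gen_S) ^^ 2) C = C" if "C \<in> R" for C
    using that rcoset_mult[OF H]
    by (auto simp: R_def RCOSETS_def numeral_2_eq_2 PSL2Z.m_assoc gen_S_square)
  have U: "((\<lambda>C. C #>\<^bsub>PSL2Z\<^esub> gen_U) ^^ 3) C = C" if "C \<in> R" for C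
    using that rcoset_mult[OF H] gen_U_cube
    by (auto simp: R_def RCOSETS_def numeral_3_eq_3 PSL2Z.m_assoc)
  obtain c where c: "c permutes f ` R" "c ^^ 2 = id" "\<And>C. C \<in> R \<Longrightarrow> c (f C) = f (C #>\<^bsub>PSL2Z\<^esub> gen_S)"
    by (rule permutes_transfer[OF inj, of "\<lambda>C. C #>\<^bsub>PSL2Z\<^esub> gen_S" 2]) (use mult S in simp_all)
  obtain d where d: "d permutes f ` R" "d ^^ 3 = id" "\<And>C. C \<in> R \<Longrightarrow> d (f C) = f (C #>\<^bsub>PSL2Z\<^esub> gen_U)"
    by (rule permutes_transfer[OF inj, of "\<lambda>C. C #>\<^bsub>PSL2Z\<^esub> gen_U" 3]) (use mult U in simp_all)
  have "{(s, t) \<in> perm_roots 2 X \<times> perm_roots 3 X. equivariant s t H f} =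
      {s \<in> perm_roots 2 X. \<forall>a\<in>f ` R. s a = c a} \<times> {t \<in> perm_roots 3 X. \<forall>a\<in>f ` R. t a = d a}"
    by (auto simp: equivariant_def R_def[symmetric] c d)
  moreover have n: "card (X - f ` R) = card X - card R"
    using fin fX card_image[OF inj] by (subst card_Diff_subset) (auto simp: R_def)
  have "card {s \<in> perm_roots 2 X. \<forall>a\<in>f ` R. s a = c a} = involutions (card X - card R)"
    unfolding card_perm_roots_extending[OF fin(2) fX c(1,2)] using fin(2)
    by (simp add: card_perm_roots_2 n)
  moreover have "card {t \<in> perm_roots 3 X. \<forall>a\<in>f ` R. t a = d a} = cube_roots (card X - card R)"
    unfolding card_perm_roots_extending[OF fin(2) fX d(1,2)] using fin(2)
    by (simp add: card_perm_roots_3 n)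
  ultimately show ?thesis by (simp only: card_cartesian_product R_def)
qed

definition pairs :: "'a set \<Rightarrow> (('a \<Rightarrow> 'a) \<times> ('a \<Rightarrow> 'a)) set" where
  "pairs X = perm_roots 2 X \<times> perm_roots 3 X"

text \<open>The fibre is a disjoint union over the embeddings f: the pair (s, t) and the value at H
  determine an equivariant f on all cosets. By \<open>card_equivariant\<close> each f contributes
  the same number.\<close>

lemma card_stab_fibre:
  assumes H: "subgroup H PSL2Z" and fin: "finite (rcosets\<^bsub>PSL2Z\<^esub> H)" "finite X" and z: "z \<in> X"
  shows "card {(s, t) \<in> pairs X. stab s t z = H} =
    (\<Prod>i<card (rcosets\<^bsub>PSL2Z\<^esub> H) - 1. card X - 1 - i) *
    (involutions (card X - card (rcosets\<^bsub>PSL2Z\<^esub> H)) * cube_roots (card X - card (rcosets\<^bsub>PSL2Z\<^esub> H)))"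
proof -
  define E where "E f = {(s, t) \<in> pairs X. equivariant s t H f}" for f
  have finP: "finite (pairs X)" using finite_perm_roots[OF fin(2)] by (simp add: pairs_def)
  have pair: "s ^^ 2 = id" "t ^^ 3 = id" "s permutes X" "t permutes X" if "(s, t) \<in> pairs X" for s t
    using that by (auto simp: pairs_def perm_roots_def)
  have stab: "stab s t z = H \<longleftrightarrow> (\<exists>f \<in> coset_embeddings H X z. equivariant s t H f)"
    if "(s, t) \<in> pairs X" for s t
    using stab_eq_iff_equivariant[OF pair(1,2)[OF that] H pair(3,4)[OF that] z] .
  then have "{(s, t) \<in> pairs X. stab s t z = H} = (\<Union>f\<in>coset_embeddings H X z. E f)"
    unfolding E_def by blast
  also have "card \<dots> = (\<Sum>f\<in>coset_embeddings H X z. card (E f))"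
  proof (intro card_UN_disjoint ballI impI)
    have "coset_embeddings H X z \<subseteq> rcosets\<^bsub>PSL2Z\<^esub> H \<rightarrow>\<^sub>E X" by (auto simp: coset_embeddings_def)
    then show "finite (coset_embeddings H X z)"
      by (rule finite_subset) (use fin in \<open>auto intro: finite_PiE\<close>)
    show "finite (E f)" for f using finP by (auto simp: E_def intro: finite_subset[rotated])
    fix f g assume f: "f \<in> coset_embeddings H X z" and g: "g \<in> coset_embeddings H X z" and "f \<noteq> g"
    show "E f \<inter> E g = {}"
    proof (rule ccontr)
      assume "E f \<inter> E g \<noteq> {}"
      then obtain s t where st: "(s, t) \<in> pairs X" "equivariant s t H f" "equivariant s t H g"
        by (auto simp: E_def)
      have "f C = g C" if "C \<in> rcosets\<^bsub>PSL2Z\<^esub> H" for C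
        using that f g equivariant_act[OF pair(1,2)[OF st(1)] H st(2)]
          equivariant_act[OF pair(1,2)[OF st(1)] H st(3)]
        by (auto simp: RCOSETS_def coset_embeddings_def)
      then have "f = g"
        using f g by (intro PiE_ext[of f "rcosets\<^bsub>PSL2Z\<^esub> H" "\<lambda>_. X" g]) (auto simp: coset_embeddings_def)
      then show False using \<open>f \<noteq> g\<close> by simp
    qed
  qed
  also have "\<dots> = (\<Sum>f\<in>coset_embeddings H X z.
      involutions (card X - card (rcosets\<^bsub>PSL2Z\<^esub> H)) * cube_roots (card X - card (rcosets\<^bsub>PSL2Z\<^esub> H)))"
    unfolding E_def pairs_def using card_equivariant[OF H fin] by (intro sum.cong) auto
  finally show ?thesis by (simp add: card_coset_embeddings[OF H fin z])
qed


section \<open>Summation over all subgroups of finite index\<close>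

definition subgroups_of_index :: "nat \<Rightarrow> (int ^ 2 ^ 2) set set set" where
  "subgroups_of_index n =
     {H. subgroup H PSL2Z \<and> finite (rcosets\<^bsub>PSL2Z\<^esub> H) \<and> card (rcosets\<^bsub>PSL2Z\<^esub> H) = n}"

lemma finite_pairs: "finite X \<Longrightarrow> finite (pairs X)"
  using finite_perm_roots by (auto simp: pairs_def)

text \<open>By \<open>card_stab_fibre\<close> the fibre over a subgroup of index n is nonempty for n
  points, so the subgroup is a stabiliser for one of finitely many pairs. This makes
  \<open>card\<close> a genuine count.\<close>

lemma finite_subgroups_of_index: "finite (subgroups_of_index n)"
proof (rule finite_subset)
  show "finite (\<Union>z\<in>{..<n}. (\<lambda>(s, t). stab s t z) ` pairs {..<n})"
    by (intro finite_UN_I finite_imageI finite_pairs) auto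
  show "subgroups_of_index n \<subseteq> (\<Union>z\<in>{..<n}. (\<lambda>(s, t). stab s t z) ` pairs {..<n})"
  proof
    fix H assume "H \<in> subgroups_of_index n"
    then have H: "subgroup H PSL2Z" "finite (rcosets\<^bsub>PSL2Z\<^esub> H)" "card (rcosets\<^bsub>PSL2Z\<^esub> H) = n"
      by (auto simp: subgroups_of_index_def)
    have "card (rcosets\<^bsub>PSL2Z\<^esub> H) > 0"
      using H(2) subgroup.subgroup_in_rcosets[OF H(1) group_PSL2Z] by (auto simp: card_gt_0_iff)
    then have "0 \<in> {..<n}" using H(3) by simp
    moreover have "(\<Prod>i<n - 1. n - 1 - i) \<noteq> 0" by auto
    then have "card {(s, t) \<in> pairs {..<n}. stab s t 0 = H} \<noteq> 0"
      using card_stab_fibre[OF H(1,2), of "{..<n}" 0] \<open>0 \<in> {..<n}\<close> H(3) by simp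
    then have "{(s, t) \<in> pairs {..<n}. stab s t 0 = H} \<noteq> {}"
      by (rule contrapos_nn) (simp only: card.empty)
    then obtain s t where st: "(s, t) \<in> pairs {..<n}" "stab s t 0 = H" by blast
    ultimately show "H \<in> (\<Union>z\<in>{..<n}. (\<lambda>(s, t). stab s t z) ` pairs {..<n})"
      by (intro UN_I[of 0] image_eqI[of _ _ "(s, t)"]) simp_all
  qed
qed

lemma stab_index:
  assumes "(s, t) \<in> pairs X" and "finite X" and "z \<in> X"
  shows "stab s t z \<in> (\<Union>k\<in>{1..card X}. subgroups_of_index k)"
proof -
  define H where "H = stab s t z"
  have st: "s ^^ 2 = id" "t ^^ 3 = id" "s permutes X" "t permutes X"
    using assms(1) by (auto simp: pairs_def perm_roots_def)
  have H: "subgroup H PSL2Z" unfolding H_def by (rule subgroup_stab[OF st(1,2)])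
  obtain f where "f \<in> coset_embeddings H X z"
    using stab_eq_iff_equivariant[OF st(1,2) H st(3,4) assms(3)] by (auto simp: H_def)
  then have f: "inj_on f (rcosets\<^bsub>PSL2Z\<^esub> H)" "f ` (rcosets\<^bsub>PSL2Z\<^esub> H) \<subseteq> X"
    by (auto simp: coset_embeddings_def)
  have fin: "finite (rcosets\<^bsub>PSL2Z\<^esub> H)" using f assms(2) by (metis finite_imageD finite_subset)
  then have "card (rcosets\<^bsub>PSL2Z\<^esub> H) > 0"
    using subgroup.subgroup_in_rcosets[OF H group_PSL2Z] by (auto simp: card_gt_0_iff)
  moreover have "card (rcosets\<^bsub>PSL2Z\<^esub> H) \<le> card X" using f assms(2) by (rule card_inj_on_le)
  ultimately show ?thesis using H fin by (auto simp: subgroups_of_index_def H_def[symmetric])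
qed

text \<open>The pairs on n points are sorted by the stabiliser of the point 0. Its index k is the
  length of an orbit, hence at most n, and the size of each class depends only on k.\<close>

theorem involutions_cube_roots_eq:
  assumes "n > 0"
  shows "involutions n * cube_roots n = (\<Sum>k=1..n. subgroup_count PSL2Z k *
    ((\<Prod>i<k - 1. n - 1 - i) * (involutions (n - k) * cube_roots (n - k))))"
proof -
  define X where "X = {..<n}"
  have X: "finite X" "card X = n" "0 \<in> X" using assms by (auto simp: X_def)
  define E where "E H = {(s, t) \<in> pairs X. stab s t 0 = H}" for H
  have "involutions n * cube_roots n = card (pairs X)"
    using X by (simp add: pairs_def card_cartesian_product card_perm_roots_2 card_perm_roots_3)
  also have "pairs X = (\<Union>H\<in>(\<Union>k\<in>{1..n}. subgroups_of_index k). E H)"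
    using stab_index[OF _ X(1,3)] X(2) by (auto simp: E_def)
  also have "card \<dots> = (\<Sum>H\<in>(\<Union>k\<in>{1..n}. subgroups_of_index k). card (E H))"
    using finite_subgroups_of_index finite_pairs[OF X(1)]
    by (intro card_UN_disjoint) (auto simp: E_def intro: finite_subset[rotated])
  also have "\<dots> = (\<Sum>k=1..n. \<Sum>H\<in>subgroups_of_index k. card (E H))"
    using finite_subgroups_of_index by (intro sum.UNION_disjoint) (auto simp: subgroups_of_index_def)
  also have "\<dots> = (\<Sum>k=1..n. \<Sum>H\<in>subgroups_of_index k.
      ((\<Prod>i<k - 1. n - 1 - i) * (involutions (n - k) * cube_roots (n - k))))"
  proof (intro sum.cong refl)
    fix k H assume "H \<in> subgroups_of_index k"
    then have "subgroup H PSL2Z" "finite (rcosets\<^bsub>PSL2Z\<^esub> H)" "card (rcosets\<^bsub>PSL2Z\<^esub> H) = k"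
      by (auto simp: subgroups_of_index_def)
    then show "card (E H) = (\<Prod>i<k - 1. n - 1 - i) * (involutions (n - k) * cube_roots (n - k))"
      unfolding E_def using card_stab_fibre[of H X 0] X by simp
  qed
  also have "\<dots> = (\<Sum>k=1..n. subgroup_count PSL2Z k *
    ((\<Prod>i<k - 1. n - 1 - i) * (involutions (n - k) * cube_roots (n - k))))"
    by (simp add: subgroup_count_def subgroups_of_index_def)
  finally show ?thesis .
qed

text \<open>The falling product equals n! / (n + 1 - k)!, which turns the recurrence, divided by n!,
  into a Cauchy product.\<close>

lemma pair_egf_deriv:
  "fps_deriv pair_egf = pair_egf * Abs_fps (\<lambda>n. of_nat (subgroup_count PSL2Z (n + 1)))"
proof (rule fps_ext)
  fix n
  have nat: "(\<Prod>i<j. n - i) * fact (n - j) = (fact n :: nat)" if "j \<le> n" for j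
    using that
  proof (induction j)
    case (Suc j)
    then have "n - j = Suc (n - Suc j)" by simp
    then have "(fact (n - j) :: nat) = (n - j) * fact (n - Suc j)" by (metis fact_Suc of_nat_id)
    then show ?case using Suc by (simp add: mult.assoc)
  qed simp
  have falling: "of_nat (\<Prod>i<j. n - i) = (fact n / fact (n - j) :: rat)" if "j \<le> n" for j
  proof -
    have "of_nat (\<Prod>i<j. n - i) * of_nat (fact (n - j)) = (of_nat (fact n) :: rat)"
      unfolding nat[OF that, symmetric] by (rule of_nat_mult[symmetric])
    then show ?thesis by (simp only: of_nat_fact eq_divide_eq fact_nonzero simp_thms if_True)
  qed
  define c :: "nat \<Rightarrow> rat" where "c k = of_nat (involutions k * cube_roots k)" for k
  have "c (n + 1) = (\<Sum>k=1..n+1. of_nat (subgroup_count PSL2Z k *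
    ((\<Prod>i<k - 1. n - i) * (involutions (n + 1 - k) * cube_roots (n + 1 - k)))))"
    unfolding c_def using involutions_cube_roots_eq[of "n + 1"] by simp
  also have "\<dots> = (\<Sum>k=1..n+1. of_nat (subgroup_count PSL2Z k) *
    (fact n / fact (n + 1 - k) * c (n + 1 - k)))"
  proof (rule sum.cong[OF refl])
    fix k assume k: "k \<in> {1..n+1}"
    then have "n - (k - 1) = n + 1 - k" "k - 1 \<le> n" by auto
    then show "of_nat (subgroup_count PSL2Z k *
        ((\<Prod>i<k - 1. n - i) * (involutions (n + 1 - k) * cube_roots (n + 1 - k)))) =
      of_nat (subgroup_count PSL2Z k) * (fact n / fact (n + 1 - k) * c (n + 1 - k))"
      using falling[of "k - 1"] by (simp only: of_nat_mult c_def)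
  qed
  also have "\<dots> = (\<Sum>i=0..n. of_nat (subgroup_count PSL2Z (n - i + 1)) * (fact n / fact i * c i))"
    by (rule sum.reindex_bij_witness[of _ "\<lambda>i. n - i + 1" "\<lambda>k. n + 1 - k"]) auto
  also have "\<dots> = fact n * (\<Sum>i=0..n. c i / fact i * of_nat (subgroup_count PSL2Z (n - i + 1)))"
    by (simp add: sum_distrib_left field_simps)
  finally have "c (n + 1) = fact n * (\<Sum>i=0..n. c i / fact i * of_nat (subgroup_count PSL2Z (n - i + 1)))" .
  moreover have "of_nat (n + 1) * (c (n + 1) / fact (n + 1)) = c (n + 1) / fact n"
  proof -
    have f: "fact (n + 1) = (of_nat (n + 1) :: rat) * fact n" by simp
    have "(of_nat (n + 1) :: rat) \<noteq> 0" unfolding of_nat_eq_0_iff by simp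
    then show ?thesis unfolding f times_divide_eq_right by (rule mult_divide_mult_cancel_left)
  qed
  ultimately show "fps_nth (fps_deriv pair_egf) n =
      fps_nth (pair_egf * Abs_fps (\<lambda>n. of_nat (subgroup_count PSL2Z (n + 1)))) n"
    unfolding fps_deriv_nth fps_mult_nth pair_egf_def fps_nth_Abs_fps c_def[symmetric] by simp
qed

section \<open>The differential ring generated by \<open>\<Phi>\<close> modulo a power of two\<close>

lemma fls_X_times_X_inv: "(fls_X :: 'a::comm_ring_1 fls) * fls_X_inv = 1"
  by (simp add: fls_X_times_conv_shift)

lemma fls_X_power_times_X_inv_power: "(fls_X :: 'a::comm_ring_1 fls) ^ n * fls_X_inv ^ n = 1"
  by (metis fls_X_times_X_inv power_mult_distrib power_one)

lemma fls_two_power_times_nth: "fls_nth (2 ^ n * f) k = 2 ^ n * fls_nth (f :: int fls) k"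
proof -
  have "(2 :: int fls) ^ n = fls_const (2 ^ n)"
    by (simp add: fls_const_power)
  then show ?thesis by simp
qed

text \<open>Turns congruence of coefficients into divisibility in the ring. The coefficientwise
  quotient vanishes below the order of f, so it is a Laurent series.\<close>

lemma fls_two_power_dvd_iff: "(2 ^ n dvd (f :: int fls)) \<longleftrightarrow> (\<forall>k. 2 ^ n dvd fls_nth f k)"
proof
  assume "2 ^ n dvd f"
  then show "\<forall>k. 2 ^ n dvd fls_nth f k"
    by (auto simp: fls_two_power_times_nth elim!: dvdE)
next
  assume *: "\<forall>k. 2 ^ n dvd fls_nth f k"
  define g where "g = Abs_fls (\<lambda>k. fls_nth f k div 2 ^ n)"
  have g: "fls_nth g k = fls_nth f k div 2 ^ n" for k
    unfolding g_def by (rule nth_Abs_fls_lower_bound[of "fls_subdegree f"]) simp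
  have "f = 2 ^ n * g"
    using * by (intro fls_eqI) (simp add: fls_two_power_times_nth g)
  then show "2 ^ n dvd f" by simp
qed

lemma fls_cong_iff_dvd: "fls_cong f g (2 ^ n) \<longleftrightarrow> 2 ^ n dvd f - g"
  by (simp add: fls_cong_def fls_two_power_dvd_iff cong_iff_dvd_diff)

text \<open>Frobenius modulo 2: in the square the products with indices i and n - i pair up, the
  middle term remains, and y^2 has the parity of y.\<close>

lemma fps_square_mod_2: "2 dvd f ^ 2 - (f oo fps_X ^ 2)" for f :: "int fps"
proof -
  have "\<exists>q. \<forall>n. fps_nth (f ^ 2 - (f oo fps_X ^ 2)) n = 2 * q n"
  proof (rule choice, rule allI)
    fix n
    have c: "fps_nth (f oo fps_X ^ 2) n = (if even n then fps_nth f (n div 2) else 0)"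
    proof -
      have "fps_nth (f oo fps_X ^ 2) n = (\<Sum>i=0..n. fps_nth f i * (if n = 2 * i then 1 else 0))"
        by (simp add: fps_compose_nth fps_X_power_nth flip: power_mult)
      also have "\<dots> = (\<Sum>i\<in>{0..n} \<inter> {i. n = 2 * i}. fps_nth f i)"
        by (subst sum.inter_restrict) (auto intro!: sum.cong)
      also have "{0..n} \<inter> {i. n = 2 * i} = (if even n then {n div 2} else {})"
        by auto
      finally show ?thesis by simp
    qed
    define h where "h = (\<lambda>i. fps_nth f i * fps_nth f (n - i))"
    define A where "A = {i. 2 * i < n}"
    define B where "B = {i. i \<le> n \<and> n < 2 * i}"
    have fin: "finite A" "finite B"
      by (auto simp: A_def B_def intro: finite_subset[of _ "{..n}"])
    have split: "{0..n} = (A \<union> B) \<union> (if even n then {n div 2} else {})"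
      by (cases "even n") (auto simp: A_def B_def elim!: evenE oddE, presburger)
    have "sum h B = sum h A"
      by (rule sum.reindex_bij_witness[of _ "\<lambda>i. n - i" "\<lambda>i. n - i"])
        (auto simp: A_def B_def h_def mult.commute)
    then have AB: "sum h (A \<union> B) = 2 * sum h A"
      using fin by (subst sum.union_disjoint) (auto simp: A_def B_def)
    have "sum h {0..n} = sum h (A \<union> B) + (if even n then h (n div 2) else 0)"
      unfolding split using fin by (subst sum.union_disjoint) (auto simp: A_def B_def)
    then have s: "fps_nth (f ^ 2) n = 2 * sum h A + (if even n then fps_nth f (n div 2) ^ 2 else 0)"
      unfolding power2_eq_square fps_mult_nth h_def[symmetric] AB
      by (auto simp: h_def power2_eq_square elim!: evenE)
    have "2 dvd y ^ 2 - y" for y :: int by auto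
    then have "2 dvd fps_nth (f ^ 2 - (f oo fps_X ^ 2)) n"
      using s c by auto
    then show "\<exists>q. fps_nth (f ^ 2 - (f oo fps_X ^ 2)) n = 2 * q"
      by (rule dvdE) auto
  qed
  then obtain q where "\<forall>n. fps_nth (f ^ 2 - (f oo fps_X ^ 2)) n = 2 * q n" ..
  then have "f ^ 2 - (f oo fps_X ^ 2) = 2 * Abs_fps q"
    by (intro fps_ext) (simp add: fps_numeral_fps_const)
  then show ?thesis by simp
qed

lemma Phi_fps_compose_square: "Phi_fps oo fps_X ^ 2 = Phi_fps - fps_X"
proof (rule fps_ext)
  fix n
  have "fps_nth (Phi_fps oo fps_X ^ 2) n =
      (\<Sum>i=0..n. fps_nth Phi_fps i * (if n = 2 * i then 1 else 0))"
    by (simp add: fps_compose_nth fps_X_power_nth flip: power_mult)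
  also have "\<dots> = (\<Sum>i\<in>{0..n} \<inter> {i. n = 2 * i}. fps_nth Phi_fps i)"
    by (subst sum.inter_restrict) (auto intro!: sum.cong)
  also have "{0..n} \<inter> {i. n = 2 * i} = (if even n then {n div 2} else {})"
    by auto
  also have "(\<Sum>i\<in>(if even n then {n div 2} else {}). fps_nth Phi_fps i) =
      (if even n then fps_nth Phi_fps (n div 2) else 0)"
    by simp
  also have "\<dots> = fps_nth (Phi_fps - fps_X) n"
  proof (cases "even n")
    case True
    then obtain m where m: "n = 2 * m" by blast
    have "(\<exists>j. m = 2 ^ j) \<longleftrightarrow> (\<exists>j. n = 2 ^ j)"
    proof
      assume "\<exists>j. m = 2 ^ j"
      then show "\<exists>j. n = 2 ^ j" using m by (metis power_Suc)
    next
      assume "\<exists>j. n = 2 ^ j"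
      then obtain j where j: "n = 2 ^ j" by blast
      with m have "j \<noteq> 0" by (cases j) auto
      then show "\<exists>j. m = 2 ^ j" using m j by (cases j) auto
    qed
    then show ?thesis using m by (auto simp: Phi_fps_def fps_X_def)
  next
    case False
    then have "(\<exists>j. n = 2 ^ j) \<longleftrightarrow> n = 1"
      by (metis even_power power_0 gr0I odd_numeral dvd_refl even_numeral)
    with False show ?thesis by (auto simp: Phi_fps_def fps_X_def)
  qed
  finally show "fps_nth (Phi_fps oo fps_X ^ 2) n = fps_nth (Phi_fps - fps_X) n" .
qed

definition \<omega> :: "int fls" where "\<omega> = \<Phi> ^ 2 - \<Phi> + fls_X"

text \<open>Modulo 2 the square of \<Phi> is \<Phi>(z^2) = \<Phi> - z, so \<omega> is even. Its half
  e has square e(z^2) modulo 2, and e(z^2) is found by substituting z^2 for z in 2 e = \<Phi>^2 -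
  \<Phi> + z.\<close>

lemma \<omega>_quadratic:
  obtains e :: "int fls" and h :: "int fls"
  where "\<omega> = 2 * e" and "e ^ 2 = e - fls_X * \<Phi> + fls_X ^ 2 + 2 * h"
proof -
  obtain e where e: "Phi_fps ^ 2 - (Phi_fps - fps_X) = 2 * e"
    using fps_square_mod_2[of Phi_fps] unfolding Phi_fps_compose_square by (auto elim: dvdE)
  obtain h where h: "e ^ 2 - (e oo fps_X ^ 2) = 2 * h"
    using fps_square_mod_2[of e] by (auto elim: dvdE)
  have z: "fps_nth (fps_X ^ 2 :: int fps) 0 = 0" by simp
  have "2 * (e oo fps_X ^ 2) = (2 * e) oo fps_X ^ 2"
    using z by (simp add: fps_compose_mult_distrib)
  also have "\<dots> = (Phi_fps - fps_X) ^ 2 - (Phi_fps - fps_X - fps_X ^ 2)"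
    unfolding e[symmetric] using z
    by (simp add: fps_compose_sub_distrib Phi_fps_compose_square flip: fps_compose_power)
  also have "\<dots> = 2 * (e - fps_X * Phi_fps + fps_X ^ 2)"
    using e by (simp add: power2_eq_square algebra_simps)
  finally have "e oo fps_X ^ 2 = e - fps_X * Phi_fps + fps_X ^ 2"
    by (metis mult_cancel_left zero_neq_numeral)
  with h have h': "e ^ 2 = e - fps_X * Phi_fps + fps_X ^ 2 + 2 * h" by (simp add: algebra_simps)
  show ?thesis
  proof
    show "\<omega> = 2 * fps_to_fls e"
      using arg_cong[OF e, of fps_to_fls]
      by (simp add: \<omega>_def \<Phi>_def fls_times_fps_to_fls fps_to_fls_power algebra_simps)
    show "fps_to_fls e ^ 2 = fps_to_fls e - fls_X * \<Phi> + fls_X ^ 2 + 2 * fps_to_fls h"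
      using arg_cong[OF h', of fps_to_fls]
      by (simp add: \<Phi>_def fls_times_fps_to_fls fps_to_fls_power algebra_simps)
  qed
qed

text \<open>The rule \<open>error\<close> makes this ring of Laurent series the preimage of a subring of the ring
  of Laurent series modulo \<open>2\<^sup>M\<close>; only thus is it closed under derivation.\<close>

inductive_set Phi_ring :: "nat \<Rightarrow> int fls set" for M :: nat where
  one: "1 \<in> Phi_ring M"
| X: "fls_X \<in> Phi_ring M"
| X_inv: "fls_X_inv \<in> Phi_ring M"
| Phi: "\<Phi> \<in> Phi_ring M"
| error: "2 ^ M * f \<in> Phi_ring M"
| add: "f \<in> Phi_ring M \<Longrightarrow> g \<in> Phi_ring M \<Longrightarrow> f + g \<in> Phi_ring M"
| diff: "f \<in> Phi_ring M \<Longrightarrow> g \<in> Phi_ring M \<Longrightarrow> f - g \<in> Phi_ring M"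
| mult: "f \<in> Phi_ring M \<Longrightarrow> g \<in> Phi_ring M \<Longrightarrow> f * g \<in> Phi_ring M"

lemma Phi_ring_0: "0 \<in> Phi_ring M"
  using Phi_ring.error[of M 0] by simp

lemma Phi_ring_uminus: "f \<in> Phi_ring M \<Longrightarrow> - f \<in> Phi_ring M"
  using Phi_ring.diff[OF Phi_ring_0] by fastforce

lemma Phi_ring_power: "f \<in> Phi_ring M \<Longrightarrow> f ^ n \<in> Phi_ring M"
  by (induction n) (auto intro: Phi_ring.intros)

lemma Phi_ring_of_nat: "of_nat n \<in> Phi_ring M"
  by (induction n) (auto intro: Phi_ring.intros Phi_ring_0)

lemma Phi_ring_numeral: "numeral n \<in> Phi_ring M"
  using Phi_ring_of_nat[of "numeral n"] by simp

lemma Phi_ring_sum: "(\<And>i. i \<in> A \<Longrightarrow> f i \<in> Phi_ring M) \<Longrightarrow> sum f A \<in> Phi_ring M"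
  by (induction A rule: infinite_finite_induct) (auto intro: Phi_ring.intros Phi_ring_0)

lemmas Phi_ring_intros = Phi_ring.intros Phi_ring_0 Phi_ring_uminus Phi_ring_power
  Phi_ring_numeral Phi_ring_sum

lemma \<omega>_in_Phi_ring: "\<omega> \<in> Phi_ring M"
  unfolding \<omega>_def by (intro Phi_ring_intros)

lemma fls_deriv_two_power [simp]: "fls_deriv (2 ^ n :: int fls) = 0"
  by (metis fls_const_numeral fls_const_power fls_deriv_const)

lemma Phi_nth: "fls_nth \<Phi> k = (if \<exists>n. k = 2 ^ n then 1 else 0)"
proof (cases "k < 0")
  case True
  then have "k \<noteq> 2 ^ n" for n by (metis not_less zero_le_numeral zero_le_power)
  moreover have "fls_nth \<Phi> k = 0" using True by (simp add: \<Phi>_def)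
  ultimately show ?thesis by simp
next
  case False
  then have "nat k = 2 ^ n \<longleftrightarrow> k = 2 ^ n" for n
    by (simp add: nat_eq_iff)
  then show ?thesis using False by (simp add: \<Phi>_def Phi_fps_def)
qed

text \<open>The derivative is the sum of 2^n z^(2^n - 1), a finite sum modulo a power of two. The
  terms 1 and 2 z are split off to leave a factor 4, which \<open>\<omega>_deriv_deriv\<close>
  needs.\<close>

lemma Phi_deriv:
  obtains y where "y \<in> Phi_ring M" and "fls_deriv \<Phi> = 1 + 2 * fls_X + 4 * y"
proof -
  define g :: "int fls" where "g = (\<Sum>n=2..M+1. 2 ^ (n - 2) * fls_X ^ (2 ^ n - 1))"
  have four: "4 * g = (\<Sum>n=2..M+1. 2 ^ n * fls_X ^ (2 ^ n - 1))"
    unfolding g_def sum_distrib_left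
  proof (rule sum.cong[OF refl])
    fix n assume "n \<in> {2..M+1}"
    then have "2 \<le> n" by simp
    then obtain m where "n = 2 + m" using le_Suc_ex by blast
    then show "4 * (2 ^ (n - 2) * fls_X ^ (2 ^ n - 1)) = (2 ^ n * fls_X ^ (2 ^ n - 1) :: int fls)"
      by simp
  qed
  \<comment> \<open>The terms from n = M + 2 on keep a factor 2^M after 4 is taken out, as the rule
    \<open>error\<close> demands.\<close>
  define K where "K = M + 2"
  have "{..<K} = {0,1} \<union> {2..M+1}" by (auto simp: K_def)
  then have g: "1 + 2 * fls_X + 4 * g = (\<Sum>n<K. 2 ^ n * fls_X ^ (2 ^ n - 1))"
    unfolding four by (simp add: sum.union_disjoint)
  have "2 ^ K dvd fls_deriv \<Phi> - (1 + 2 * fls_X + 4 * g)"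
    unfolding fls_two_power_dvd_iff
  proof
    fix k :: int
    have "fls_nth (2 ^ n * fls_X ^ (2 ^ n - 1)) k = (if k + 1 = 2 ^ n then 2 ^ n else 0 :: int)" for n
      by (auto simp: fls_two_power_times_nth of_nat_diff)
    then have e: "fls_nth (1 + 2 * fls_X + 4 * g) k =
        (\<Sum>n<K. if k + 1 = 2 ^ n then 2 ^ n else 0)"
      unfolding g fls_nth_sum by (rule sum.cong[OF refl])
    have d: "fls_nth (fls_deriv \<Phi>) k = (if \<exists>n. k + 1 = 2 ^ n then k + 1 else 0)"
      unfolding fls_deriv_nth Phi_nth by simp
    show "2 ^ K dvd fls_nth (fls_deriv \<Phi> - (1 + 2 * fls_X + 4 * g)) k"
    proof (cases "\<exists>n. k + 1 = 2 ^ n")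
      case True
      then obtain m where m: "k + 1 = 2 ^ m" by blast
      have "fls_nth (fls_deriv \<Phi> - (1 + 2 * fls_X + 4 * g)) k =
          2 ^ m - (\<Sum>n<K. if m = n then 2 ^ n else 0)"
        unfolding fls_minus_nth d e m by auto
      then show ?thesis
        by (cases "m < K") (simp_all add: le_imp_power_dvd)
    next
      case False
      then have "fls_nth (fls_deriv \<Phi> - (1 + 2 * fls_X + 4 * g)) k = 0"
        unfolding fls_minus_nth d e by (simp only: if_False if_cancel sum.neutral_const) simp
      then show ?thesis by simp
    qed
  qed
  then obtain h where h: "fls_deriv \<Phi> - (1 + 2 * fls_X + 4 * g) = 2 ^ K * h" by (auto elim: dvdE)
  show ?thesis
  proof
    show "g + 2 ^ M * h \<in> Phi_ring M"
      unfolding g_def by (intro Phi_ring_intros)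
    show "fls_deriv \<Phi> = 1 + 2 * fls_X + 4 * (g + 2 ^ M * h)"
      using h by (simp add: K_def power_add algebra_simps)
  qed
qed

lemma Phi_ring_deriv: "f \<in> Phi_ring M \<Longrightarrow> fls_deriv f \<in> Phi_ring M"
proof (induction rule: Phi_ring.induct)
  case Phi
  obtain y where "y \<in> Phi_ring M" and "fls_deriv \<Phi> = 1 + 2 * fls_X + 4 * y"
    by (rule Phi_deriv)
  then show ?case by (auto intro!: Phi_ring_intros)
qed (auto intro!: Phi_ring_intros)

text \<open>Second derivatives of integer series are even; the point is that the half stays in the
  ring. In products the mixed term of the Leibniz rule is 2 f' g'.\<close>

lemma Phi_ring_deriv_deriv:
  "f \<in> Phi_ring M \<Longrightarrow> \<exists>g\<in>Phi_ring M. fls_deriv (fls_deriv f) = 2 * g"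
proof (induction rule: Phi_ring.induct)
  case X_inv
  have "fls_deriv (fls_deriv fls_X_inv) = 2 * (fls_X_inv ^ 3 :: int fls)"
    by (simp add: power2_eq_square power3_eq_cube algebra_simps)
  then show ?case by (blast intro: Phi_ring_intros)
next
  case Phi
  obtain y where y: "y \<in> Phi_ring M" "fls_deriv \<Phi> = 1 + 2 * fls_X + 4 * y"
    by (rule Phi_deriv)
  have "fls_deriv (fls_deriv \<Phi>) = 2 * (1 + 2 * fls_deriv y)"
    by (simp add: y)
  then show ?case using y by (blast intro: Phi_ring_intros Phi_ring_deriv)
next
  case (error f)
  have "2 ^ 1 dvd fls_deriv (fls_deriv f)"
    unfolding fls_two_power_dvd_iff by (simp add: algebra_simps)
  then obtain h where "fls_deriv (fls_deriv f) = 2 * h" by (auto elim: dvdE)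
  then have "fls_deriv (fls_deriv (2 ^ M * f)) = 2 * (2 ^ M * h)"
    by simp
  then show ?case by (blast intro: Phi_ring_intros)
next
  case (add f g)
  then obtain f' g' where "f' \<in> Phi_ring M" "fls_deriv (fls_deriv f) = 2 * f'"
    "g' \<in> Phi_ring M" "fls_deriv (fls_deriv g) = 2 * g'" by blast
  then show ?case by (intro bexI[of _ "f' + g'"]) (auto intro: Phi_ring_intros simp: algebra_simps)
next
  case (diff f g)
  then obtain f' g' where "f' \<in> Phi_ring M" "fls_deriv (fls_deriv f) = 2 * f'"
    "g' \<in> Phi_ring M" "fls_deriv (fls_deriv g) = 2 * g'" by blast
  then show ?case by (intro bexI[of _ "f' - g'"]) (auto intro: Phi_ring_intros simp: algebra_simps)
next
  case (mult f g)
  then obtain f' g' where *: "f' \<in> Phi_ring M" "fls_deriv (fls_deriv f) = 2 * f'"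
    "g' \<in> Phi_ring M" "fls_deriv (fls_deriv g) = 2 * g'" by blast
  have "fls_deriv (fls_deriv (f * g)) = 2 * (f' * g + fls_deriv f * fls_deriv g + f * g')"
    by (simp add: * algebra_simps)
  then show ?case using * mult by (blast intro: Phi_ring_intros Phi_ring_deriv)
qed (auto intro: exI bexI[of _ 0] Phi_ring_0)

text \<open>The power \<open>I\<^sup>k\<close> of the ideal \<open>I\<close> generated by 2 and \<open>\<omega>\<close>.\<close>

primrec Phi_ideal :: "nat \<Rightarrow> nat \<Rightarrow> int fls set" where
  "Phi_ideal M 0 = Phi_ring M"
| "Phi_ideal M (Suc k) = {2 * f + \<omega> * g | f g. f \<in> Phi_ideal M k \<and> g \<in> Phi_ideal M k}"

lemma Phi_ideal_SucI:
  "f \<in> Phi_ideal M k \<Longrightarrow> g \<in> Phi_ideal M k \<Longrightarrow> 2 * f + \<omega> * g \<in> Phi_ideal M (Suc k)"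
  by auto

lemma Phi_ideal_SucE:
  assumes "f \<in> Phi_ideal M (Suc k)"
  obtains a b where "f = 2 * a + \<omega> * b" "a \<in> Phi_ideal M k" "b \<in> Phi_ideal M k"
  using assms by auto

declare Phi_ideal.simps(2) [simp del]

lemma Phi_ideal_0: "0 \<in> Phi_ideal M k"
proof (induction k)
  case (Suc k)
  then show ?case using Phi_ideal_SucI[of 0 M k 0] by simp
qed (simp add: Phi_ring_0)

lemma Phi_ideal_add: "f \<in> Phi_ideal M k \<Longrightarrow> g \<in> Phi_ideal M k \<Longrightarrow> f + g \<in> Phi_ideal M k"
proof (induction k arbitrary: f g)
  case (Suc k)
  then obtain a b c d where "f = 2 * a + \<omega> * b" "g = 2 * c + \<omega> * d"
    and *: "a \<in> Phi_ideal M k" "b \<in> Phi_ideal M k" "c \<in> Phi_ideal M k" "d \<in> Phi_ideal M k"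
    by (meson Phi_ideal_SucE)
  then have "f + g = 2 * (a + c) + \<omega> * (b + d)" by (simp add: algebra_simps)
  then show ?case using Suc.IH * by (simp only: Phi_ideal_SucI)
qed (auto intro: Phi_ring_intros)

lemma Phi_ideal_mult_left: "f \<in> Phi_ring M \<Longrightarrow> g \<in> Phi_ideal M k \<Longrightarrow> f * g \<in> Phi_ideal M k"
proof (induction k arbitrary: g)
  case (Suc k)
  then obtain c d where "g = 2 * c + \<omega> * d"
    and *: "c \<in> Phi_ideal M k" "d \<in> Phi_ideal M k"
    by (meson Phi_ideal_SucE)
  then have "f * g = 2 * (f * c) + \<omega> * (f * d)" by (simp add: algebra_simps)
  then show ?case using Suc * by (simp add: Phi_ideal_SucI)
qed (auto intro: Phi_ring_intros)

lemma Phi_ideal_two: "f \<in> Phi_ideal M k \<Longrightarrow> 2 * f \<in> Phi_ideal M (Suc k)"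
  using Phi_ideal_SucI[OF _ Phi_ideal_0] by simp

lemma Phi_ideal_Suc_subset: "Phi_ideal M (Suc k) \<subseteq> Phi_ideal M k"
  by (auto elim!: Phi_ideal_SucE
      intro!: Phi_ideal_add Phi_ideal_mult_left Phi_ring_numeral \<omega>_in_Phi_ring)

lemma Phi_ideal_antimono: "j \<le> k \<Longrightarrow> Phi_ideal M k \<subseteq> Phi_ideal M j"
  using lift_Suc_antimono_le[of "Phi_ideal M"] Phi_ideal_Suc_subset by blast

lemma Phi_ideal_mult:
  "f \<in> Phi_ideal M j \<Longrightarrow> g \<in> Phi_ideal M k \<Longrightarrow> f * g \<in> Phi_ideal M (j + k)"
proof (induction j arbitrary: f)
  case (Suc j)
  then obtain c d where "f = 2 * c + \<omega> * d"
    and *: "c \<in> Phi_ideal M j" "d \<in> Phi_ideal M j"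
    by (meson Phi_ideal_SucE)
  then have "f * g = 2 * (c * g) + \<omega> * (d * g)" by (simp add: algebra_simps)
  then show ?case using Suc * by (simp add: Phi_ideal_SucI)
qed (auto intro: Phi_ideal_mult_left)

lemma Phi_ideal_imp_dvd: "f \<in> Phi_ideal M k \<Longrightarrow> 2 ^ k dvd f"
proof (induction k arbitrary: f)
  case (Suc k)
  obtain e h where "\<omega> = 2 * e" by (rule \<omega>_quadratic)
  moreover obtain c d where "f = 2 * c + \<omega> * d"
    and *: "c \<in> Phi_ideal M k" "d \<in> Phi_ideal M k"
    using Suc.prems by (rule Phi_ideal_SucE)
  moreover have "2 ^ k dvd c + e * d" using * Suc.IH by auto
  then have "2 ^ Suc k dvd 2 * (c + e * d)" by (metis mult_dvd_mono power_Suc dvd_refl)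
  ultimately show ?case by (simp add: algebra_simps)
qed auto

lemma \<omega>_deriv: "\<exists>u\<in>Phi_ring M. fls_deriv \<omega> = 2 * u"
proof -
  obtain y where y: "y \<in> Phi_ring M" "fls_deriv \<Phi> = 1 + 2 * fls_X + 4 * y"
    by (rule Phi_deriv)
  have "fls_deriv \<omega> = 2 * (\<Phi> * fls_deriv \<Phi> - fls_X - 2 * y)"
    by (simp add: \<omega>_def power2_eq_square y algebra_simps)
  moreover have "\<Phi> * fls_deriv \<Phi> - fls_X - 2 * y \<in> Phi_ring M"
    using y by (intro Phi_ring_intros Phi_ring_deriv)
  ultimately show ?thesis by blast
qed

lemma \<omega>_deriv_deriv: "\<exists>v\<in>Phi_ring M. fls_deriv (fls_deriv \<omega>) = 4 * v"
proof -
  obtain y where y: "y \<in> Phi_ring M" "fls_deriv \<Phi> = 1 + 2 * fls_X + 4 * y"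
    by (rule Phi_deriv)
  let ?v = "2 * (fls_X + 2 * y) + 2 * (fls_X + 2 * y) ^ 2 + \<Phi> * (1 + 2 * fls_deriv y) - fls_deriv y"
  have "fls_deriv (fls_deriv \<omega>) = 4 * ?v"
    by (simp add: \<omega>_def power2_eq_square y algebra_simps)
  moreover have "?v \<in> Phi_ring M"
    using y by (intro Phi_ring_intros Phi_ring_deriv)
  ultimately show ?thesis by blast
qed

lemma Phi_ideal_deriv: "f \<in> Phi_ideal M k \<Longrightarrow> fls_deriv f \<in> Phi_ideal M k"
proof (induction k arbitrary: f)
  case (Suc k)
  then obtain c d where f: "f = 2 * c + \<omega> * d"
    and *: "c \<in> Phi_ideal M k" "d \<in> Phi_ideal M k"
    by (meson Phi_ideal_SucE)
  obtain u where u: "u \<in> Phi_ring M" "fls_deriv \<omega> = 2 * u" using \<omega>_deriv by blast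
  have "fls_deriv f = 2 * (fls_deriv c + u * d) + \<omega> * fls_deriv d"
    by (simp add: f u algebra_simps)
  then show ?case
    using Suc.IH * u by (simp only: Phi_ideal_SucI Phi_ideal_add Phi_ideal_mult_left)
qed (auto intro: Phi_ring_deriv)

text \<open>For f = 2 c + \<omega> d with c, d in I^k, the terms 2 \<omega>' d' and \<omega>'' d
  carry a factor 4, hence lie in I^(k+2); the rest is covered by the induction hypothesis.\<close>

lemma Phi_ideal_deriv_deriv:
  "f \<in> Phi_ideal M k \<Longrightarrow> fls_deriv (fls_deriv f) \<in> Phi_ideal M (Suc k)"
proof (induction k arbitrary: f)
  case 0
  then obtain g where "g \<in> Phi_ring M" "fls_deriv (fls_deriv f) = 2 * g"
    using Phi_ring_deriv_deriv by auto
  then show ?case using Phi_ideal_two[of g M 0] by simp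
next
  case (Suc k)
  then obtain c d where f: "f = 2 * c + \<omega> * d"
    and *: "c \<in> Phi_ideal M k" "d \<in> Phi_ideal M k"
    by (meson Phi_ideal_SucE)
  obtain u where u: "u \<in> Phi_ring M" "fls_deriv \<omega> = 2 * u" using \<omega>_deriv by blast
  obtain v where v: "v \<in> Phi_ring M" "fls_deriv (fls_deriv \<omega>) = 4 * v"
    using \<omega>_deriv_deriv by blast
  have "fls_deriv (fls_deriv f) = (2 * fls_deriv (fls_deriv c) + \<omega> * fls_deriv (fls_deriv d)) +
      2 * (fls_deriv \<omega> * fls_deriv d) + fls_deriv (fls_deriv \<omega>) * d"
    by (simp add: f algebra_simps)
  also have "\<dots> = (2 * fls_deriv (fls_deriv c) + \<omega> * fls_deriv (fls_deriv d)) +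
      2 * (2 * (u * fls_deriv d)) + 2 * (2 * (v * d))"
    unfolding v(2) unfolding u(2) by simp
  finally show ?case
    using Suc.IH[OF *(1)] Suc.IH[OF *(2)] Phi_ideal_deriv[OF *(2)] *(2) u(1) v(1)
    by (simp only: Phi_ideal_add Phi_ideal_SucI Phi_ideal_two Phi_ideal_mult_left)
qed


section \<open>The Riccati equation\<close>

definition lin_coeff :: "int fls" where
  "lin_coeff = -1 + 3 * fls_X ^ 3 + 2 * fls_X ^ 4 + 7 * fls_X ^ 6 - 2 * fls_X ^ 7 - 4 * fls_X ^ 9"

definition riccati :: "int fls \<Rightarrow> int fls" where
  "riccati w = lin_coeff * w + fls_X ^ 7 * fls_deriv w + (fls_X ^ 7 - fls_X ^ 10) * w ^ 2
     + (2 + fls_X + 6 * fls_X ^ 2 + 4 * fls_X ^ 3 - fls_X ^ 4 + 8 * fls_X ^ 5 - 4 * fls_X ^ 6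
        - 4 * fls_X ^ 8)"

text \<open>The quadratic contribution carries the factor 2 w + y. For y in I^k with k >= 1 it lies
  in I^(k+1), so up to such terms the linearisation does not depend on w.\<close>

lemma riccati_add:
  "riccati (w + y) = riccati w + lin_coeff * y + fls_X ^ 7 * fls_deriv y
     + (fls_X ^ 7 - fls_X ^ 10) * y * (2 * w + y)"
  by (simp add: riccati_def power2_eq_square algebra_simps)

text \<open>Modulo 2 every second derivative vanishes, so a series splits into its even part
  \<open>f + z f'\<close> and its odd part \<open>z f'\<close>. Solving the linear part of the Riccati equation for these
  two parts leads to this operator.\<close>

definition lin_inverse :: "int fls \<Rightarrow> int fls" where
  "lin_inverse f = (1 + fls_X ^ 3) * f + fls_X ^ 7 * fls_deriv f"

lemma lin_inverse_right:
  "lin_coeff * lin_inverse f + fls_X ^ 7 * fls_deriv (lin_inverse f) =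
    - f + 2 * ((fls_X ^ 3 + fls_X ^ 4 + 5 * fls_X ^ 6 + 3 * fls_X ^ 9 - fls_X ^ 10 - 2 * fls_X ^ 12) * f)
    + 2 * ((fls_X ^ 7 * (2 * fls_X ^ 3 + fls_X ^ 4 + 7 * fls_X ^ 6 - fls_X ^ 7 - 2 * fls_X ^ 9)) * fls_deriv f)
    + fls_X ^ 14 * fls_deriv (fls_deriv f)"
proof -
  have "fls_deriv (lin_inverse f) = 3 * fls_X ^ 2 * f + (1 + fls_X ^ 3 + 7 * fls_X ^ 6) * fls_deriv f
      + fls_X ^ 7 * fls_deriv (fls_deriv f)"
    by (simp add: lin_inverse_def fls_deriv_X_power algebra_simps)
  then show ?thesis
    unfolding lin_coeff_def lin_inverse_def by algebra
qed

text \<open>Modulo 2 the linear operator has trivial kernel: minus \<open>lin_inverse\<close>,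
  applied to its value 2 g, gives back f up to even terms because f'' is even.\<close>

lemma lin_inverse_left:
  assumes "2 dvd lin_coeff * f + fls_X ^ 7 * fls_deriv f"
  shows "2 dvd f"
proof -
  obtain g where g: "lin_coeff * f + fls_X ^ 7 * fls_deriv f = 2 * g" using assms by (rule dvdE)
  have "2 ^ 1 dvd fls_deriv (fls_deriv f)"
    unfolding fls_two_power_dvd_iff by (simp add: algebra_simps)
  then obtain h where h: "fls_deriv (fls_deriv f) = 2 * h" by (auto elim: dvdE)
  have "2 * fls_deriv g = fls_deriv (2 * g)" by simp
  also have "\<dots> = lin_coeff * fls_deriv f
      + (9 * fls_X ^ 2 + 8 * fls_X ^ 3 + 42 * fls_X ^ 5 - 14 * fls_X ^ 6 - 36 * fls_X ^ 8) * f
      + fls_X ^ 7 * (2 * h) + 7 * fls_X ^ 6 * fls_deriv f"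
    unfolding g[symmetric] lin_coeff_def by (simp add: h fls_deriv_X_power algebra_simps)
  finally have d: "2 * fls_deriv g = \<dots>" .
  have eq: "f = 2 * ((fls_X ^ 3 + fls_X ^ 4 + 5 * fls_X ^ 6 + 6 * fls_X ^ 9 + 3 * fls_X ^ 10
          + 19 * fls_X ^ 12 - 7 * fls_X ^ 13 - 18 * fls_X ^ 15) * f
      + fls_X ^ 7 * (2 * fls_X ^ 3 + fls_X ^ 4 + 7 * fls_X ^ 6 - fls_X ^ 7 - 2 * fls_X ^ 9) * fls_deriv f
      + fls_X ^ 14 * h) - (1 + fls_X ^ 3) * (2 * g) - fls_X ^ 7 * (2 * fls_deriv g)"
    unfolding d g[symmetric] lin_coeff_def by algebra
  show ?thesis
    by (subst eq) (rule dvd_diff[OF dvd_diff[OF dvd_triv_left dvd_mult[OF dvd_triv_left]]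
          dvd_mult[OF dvd_triv_left]])
qed

text \<open>Newton step adding \<open>lin_inverse (riccati w)\<close>. By
  \<open>lin_inverse_right\<close> the linear part leaves multiples of 2 f, 2 f' and f'', all in the
  next power of I; the quadratic part consists of multiples of 2 y and y^2.\<close>

lemma riccati_step:
  assumes w: "w \<in> Phi_ring M" and "riccati w \<in> Phi_ideal M (Suc k)"
  obtains w' where "w' \<in> Phi_ring M" and "riccati w' \<in> Phi_ideal M (Suc (Suc k))"
    and "w' - w \<in> Phi_ideal M (Suc k)"
proof
  define f where "f = riccati w"
  define y where "y = lin_inverse f"
  define r :: "int fls" where "r = fls_X ^ 7 - fls_X ^ 10"
  define A :: "int fls" where
    "A = fls_X ^ 3 + fls_X ^ 4 + 5 * fls_X ^ 6 + 3 * fls_X ^ 9 - fls_X ^ 10 - 2 * fls_X ^ 12"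
  define B :: "int fls" where
    "B = fls_X ^ 7 * (2 * fls_X ^ 3 + fls_X ^ 4 + 7 * fls_X ^ 6 - fls_X ^ 7 - 2 * fls_X ^ 9)"
  have r: "r \<in> Phi_ring M" unfolding r_def by (intro Phi_ring_intros)
  have A: "A \<in> Phi_ring M" unfolding A_def by (intro Phi_ring_intros)
  have B: "B \<in> Phi_ring M" unfolding B_def by (intro Phi_ring_intros)
  have f: "f \<in> Phi_ideal M (Suc k)" using assms by (simp add: f_def)
  have f': "fls_deriv f \<in> Phi_ideal M (Suc k)" using f by (rule Phi_ideal_deriv)
  have X: "1 + fls_X ^ 3 \<in> Phi_ring M" "fls_X ^ n \<in> Phi_ring M" for n
    by (intro Phi_ring_intros)+
  have y: "y \<in> Phi_ideal M (Suc k)"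
    unfolding y_def lin_inverse_def
    by (rule Phi_ideal_add[OF Phi_ideal_mult_left[OF X(1) f] Phi_ideal_mult_left[OF X(2) f']])
  then show "w + y - w \<in> Phi_ideal M (Suc k)" by simp
  have "y \<in> Phi_ring M"
    using y Phi_ideal_antimono[of 0 "Suc k" M] by auto
  then show "w + y \<in> Phi_ring M" using w by (rule Phi_ring.add[rotated])
  have yy: "y * y \<in> Phi_ideal M (Suc (Suc k))"
    using Phi_ideal_mult[OF y y] Phi_ideal_antimono[of "Suc (Suc k)" "Suc k + Suc k" M] by auto
  have q: "r * y * (2 * w + y) = r * w * (2 * y) + r * (y * y)"
    by (simp add: algebra_simps)
  have eq: "riccati (w + y) =
     2 * (A * f) + 2 * (B * fls_deriv f) + fls_X ^ 14 * fls_deriv (fls_deriv f)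
     + (r * w * (2 * y) + r * (y * y))"
    unfolding riccati_add f_def[symmetric] add.assoc[of f] r_def[symmetric] q
    unfolding y_def lin_inverse_right A_def[symmetric] B_def[symmetric]
    by (simp only: add.assoc add_minus_cancel)
  show "riccati (w + y) \<in> Phi_ideal M (Suc (Suc k))"
    unfolding eq
    by (rule Phi_ideal_add[OF Phi_ideal_add[OF Phi_ideal_add[OF
          Phi_ideal_two[OF Phi_ideal_mult_left[OF A f]]
          Phi_ideal_two[OF Phi_ideal_mult_left[OF B f']]]
          Phi_ideal_mult_left[OF X(2) Phi_ideal_deriv_deriv[OF f]]]
        Phi_ideal_add[OF Phi_ideal_mult_left[OF Phi_ring.mult[OF r w] Phi_ideal_two[OF y]]
          Phi_ideal_mult_left[OF r yy]]])
qed

text \<open>The choice reflects Stothers's theorem: the number of subgroups of index \<open>n\<close> is odd if and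
  only if \<open>n\<close> is of the form \<open>2\<^sup>k - 3\<close> or \<open>2\<^bsup>k+1\<^esup> - 6\<close> with \<open>k \<ge> 2\<close>.\<close>

definition base_solution :: "int fls" where
  "base_solution = fls_X_inv ^ 7 * (\<Phi> - fls_X - fls_X ^ 2 - fls_X ^ 4)"

lemma riccati_base_solution: "riccati base_solution \<in> Phi_ideal M 1"
proof -
  obtain y where y: "y \<in> Phi_ring M" "fls_deriv \<Phi> = 1 + 2 * fls_X + 4 * y"
    by (rule Phi_deriv)
  define u where "u = \<Phi> - fls_X - fls_X ^ 2 - fls_X ^ 4"
  define w where "w = base_solution"
  have inv: "fls_X * fls_X_inv = (1 :: int fls)" by (rule fls_X_times_X_inv)
  have xw: "fls_X ^ 7 * w = u"
    unfolding w_def base_solution_def u_def[symmetric]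
    by (simp only: mult.assoc[symmetric] fls_X_power_times_X_inv_power mult_1)
  have "fls_deriv u = fls_deriv (fls_X ^ 7 * w)" by (simp add: xw)
  then have "7 * fls_X ^ 6 * w + fls_X ^ 7 * fls_deriv w = fls_deriv u"
    by (simp add: fls_deriv_X_power algebra_simps)
  \<comment> \<open>This derivative is even, so z^7 w' becomes z^6 w modulo 2.\<close>
  moreover have "fls_deriv u = 2 * (2 * y) - 4 * fls_X ^ 3"
    unfolding u_def by (simp add: y fls_deriv_X_power)
  ultimately have dw: "fls_X ^ 7 * fls_deriv w = 2 * (2 * y) - 4 * fls_X ^ 3 - 7 * fls_X ^ 6 * w"
    by (simp add: algebra_simps)
  have "(fls_X ^ 7 - fls_X ^ 10) * w ^ 2 = (1 - fls_X ^ 3) * u * w"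
    unfolding xw[symmetric] by algebra
  moreover have "w = fls_X_inv ^ 7 * u"
    by (simp add: w_def base_solution_def u_def)
  ultimately have quad: "(fls_X ^ 7 - fls_X ^ 10) * w ^ 2 = (1 - fls_X ^ 3) * w +
      (1 - fls_X ^ 3) * fls_X_inv ^ 7 * (u ^ 2 - u)"
    by algebra
  \<comment> \<open>Modulo 2 this is \<omega> + z^8. Multiplied by (1 - z^3) z^-7, the term z^8
    cancels modulo 2 against the odd terms z and z^4 of the inhomogeneous part.\<close>
  have uu: "u ^ 2 - u = \<omega> + 2 * (fls_X ^ 2 + fls_X ^ 3 + fls_X ^ 4 + fls_X ^ 5 + fls_X ^ 6
      - \<Phi> * (fls_X + fls_X ^ 2 + fls_X ^ 4)) + fls_X ^ 8"
    unfolding u_def \<omega>_def by algebra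
  have x8: "fls_X_inv ^ 7 * fls_X ^ 8 = (fls_X :: int fls)"
    using inv by algebra
  have "riccati w = 2 * ((fls_X ^ 3 + fls_X ^ 4 - fls_X ^ 7 - 2 * fls_X ^ 9) * w
      + (1 - fls_X ^ 3) * fls_X_inv ^ 7 * (fls_X ^ 2 + fls_X ^ 3 + fls_X ^ 4 + fls_X ^ 5 + fls_X ^ 6
          - \<Phi> * (fls_X + fls_X ^ 2 + fls_X ^ 4))
      + (2 * y + 1 + fls_X + 3 * fls_X ^ 2 - fls_X ^ 4 + 4 * fls_X ^ 5 - 2 * fls_X ^ 6 - 2 * fls_X ^ 8))
      + \<omega> * ((1 - fls_X ^ 3) * fls_X_inv ^ 7)
      + (1 - fls_X ^ 3) * (fls_X_inv ^ 7 * fls_X ^ 8 - fls_X)"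
    unfolding riccati_def lin_coeff_def dw quad uu by algebra
  then have eq: "riccati w = 2 * ((fls_X ^ 3 + fls_X ^ 4 - fls_X ^ 7 - 2 * fls_X ^ 9) * w
      + (1 - fls_X ^ 3) * fls_X_inv ^ 7 * (fls_X ^ 2 + fls_X ^ 3 + fls_X ^ 4 + fls_X ^ 5 + fls_X ^ 6
          - \<Phi> * (fls_X + fls_X ^ 2 + fls_X ^ 4))
      + (2 * y + 1 + fls_X + 3 * fls_X ^ 2 - fls_X ^ 4 + 4 * fls_X ^ 5 - 2 * fls_X ^ 6 - 2 * fls_X ^ 8))
      + \<omega> * ((1 - fls_X ^ 3) * fls_X_inv ^ 7)"
    unfolding x8 by simp
  have "w \<in> Phi_ring M"
    unfolding w_def base_solution_def by (intro Phi_ring_intros)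
  then have "riccati w \<in> Phi_ideal M (Suc 0)"
    unfolding eq by (intro Phi_ideal_SucI) (use y in \<open>auto intro!: Phi_ring_intros\<close>)
  then show ?thesis by (simp add: w_def)
qed

text \<open>The condition modulo 2 records which solution is approximated; it persists because every
  correction lies in I.\<close>

lemma riccati_approx:
  "\<exists>w\<in>Phi_ring M. riccati w \<in> Phi_ideal M (Suc k) \<and> 2 dvd w - base_solution"
proof (induction k)
  case 0
  have "base_solution \<in> Phi_ring M"
    unfolding base_solution_def by (intro Phi_ring_intros)
  then show ?case using riccati_base_solution[of M] by (intro bexI[of _ base_solution]) auto
next
  case (Suc k)
  then obtain w where w: "w \<in> Phi_ring M" "riccati w \<in> Phi_ideal M (Suc k)"
    "2 dvd w - base_solution" by blast
  obtain w' where w': "w' \<in> Phi_ring M" "riccati w' \<in> Phi_ideal M (Suc (Suc k))"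
    "w' - w \<in> Phi_ideal M (Suc k)" using riccati_step[OF w(1,2)] .
  have "2 dvd w' - w" using Phi_ideal_imp_dvd[OF w'(3)] by (metis dvd_mult_left power_Suc)
  with w(3) have "2 dvd (w' - w) + (w - base_solution)" by (rule dvd_add[rotated])
  with w' show ?case by auto
qed

text \<open>From 2^j to 2^(j+1): put w = v + 2^j d and divide the expanded equation by 2^j. As j >=
  1, the quadratic term is even, so the linear operator maps d to an even series and
  \<open>lin_inverse_left\<close> applies.\<close>

lemma riccati_solution_unique:
  assumes "riccati w = 0" and "2 ^ M dvd riccati v" and "2 dvd w - v"
  shows "2 ^ M dvd w - v"
proof (cases "M = 0")
  case False
  have "1 \<le> j \<Longrightarrow> j \<le> M \<Longrightarrow> 2 ^ j dvd w - v" for j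
  proof (induction j rule: dec_induct)
    case base
    then show ?case using assms by simp
  next
    case (step j)
    then obtain d where d: "w = v + 2 ^ j * d" by (metis add.commute diff_add_cancel dvdE Suc_leD)
    have "2 ^ j * 2 dvd (2 :: int fls) ^ M"
      using step by (metis le_imp_power_dvd power_Suc2)
    then obtain h where h: "riccati v = 2 ^ j * (2 * h)"
      using assms(2) by (metis dvd_trans dvdE mult.assoc)
    have "2 ^ j * (2 * h + lin_coeff * d + fls_X ^ 7 * fls_deriv d
       + (fls_X ^ 7 - fls_X ^ 10) * d * (2 * v + 2 ^ j * d)) = 0"
      using assms(1) unfolding d riccati_add h by (simp add: algebra_simps)
    then have "2 * h + lin_coeff * d + fls_X ^ 7 * fls_deriv d
       + (fls_X ^ 7 - fls_X ^ 10) * d * (2 * v + 2 ^ j * d) = 0"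
      by simp
    moreover have "(2 :: int fls) ^ j = 2 * 2 ^ (j - 1)"
      using step by (cases j) auto
    ultimately have "lin_coeff * d + fls_X ^ 7 * fls_deriv d
       = 2 * (- h - (fls_X ^ 7 - fls_X ^ 10) * d * (v + 2 ^ (j - 1) * d))"
      by (simp add: algebra_simps)
    then have "2 dvd lin_coeff * d + fls_X ^ 7 * fls_deriv d" by simp
    then have "2 dvd d" by (rule lin_inverse_left)
    then show ?case using d by (auto elim!: dvdE)
  qed
  then show ?thesis using False by auto
qed simp

section \<open>Reduction of the degree\<close>

lemma laurent_polynomial_0: "laurent_polynomial 0"
  by (simp add: laurent_polynomial_def)

lemma laurent_polynomial_1: "laurent_polynomial 1"
  unfolding laurent_polynomial_def by (rule finite_subset[of _ "{0}"]) auto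

lemma laurent_polynomial_X: "laurent_polynomial fls_X"
  unfolding laurent_polynomial_def by (rule finite_subset[of _ "{1}"]) auto

lemma laurent_polynomial_X_inv: "laurent_polynomial fls_X_inv"
  unfolding laurent_polynomial_def by (rule finite_subset[of _ "{-1}"]) auto

lemma laurent_polynomial_add:
  "laurent_polynomial f \<Longrightarrow> laurent_polynomial g \<Longrightarrow> laurent_polynomial (f + g)"
  unfolding laurent_polynomial_def
  by (rule finite_subset[of _ "{k. fls_nth f k \<noteq> 0} \<union> {k. fls_nth g k \<noteq> 0}"]) auto

lemma laurent_polynomial_uminus: "laurent_polynomial f \<Longrightarrow> laurent_polynomial (- f)"
  by (simp add: laurent_polynomial_def)

lemma laurent_polynomial_diff:
  "laurent_polynomial f \<Longrightarrow> laurent_polynomial g \<Longrightarrow> laurent_polynomial (f - g)"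
  using laurent_polynomial_add[of f "- g"] laurent_polynomial_uminus by simp

lemma laurent_polynomial_mult:
  assumes "laurent_polynomial f" and "laurent_polynomial g"
  shows "laurent_polynomial (f * g)"
  unfolding laurent_polynomial_def
proof (rule finite_subset)
  show "finite ((\<lambda>(i, j). i + j) ` ({k. fls_nth f k \<noteq> 0} \<times> {k. fls_nth g k \<noteq> 0}))"
    using assms by (simp add: laurent_polynomial_def)
  show "{k. fls_nth (f * g) k \<noteq> 0} \<subseteq> (\<lambda>(i, j). i + j) ` ({k. fls_nth f k \<noteq> 0} \<times> {k. fls_nth g k \<noteq> 0})"
  proof
    fix k assume "k \<in> {k. fls_nth (f * g) k \<noteq> 0}"
    then have "(\<Sum>i=fls_subdegree f..k - fls_subdegree g. fls_nth f i * fls_nth g (k - i)) \<noteq> 0"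
      by (simp add: fls_times_nth(2))
    then obtain i where "fls_nth f i * fls_nth g (k - i) \<noteq> 0" by (meson sum.neutral)
    then show "k \<in> (\<lambda>(i, j). i + j) ` ({k. fls_nth f k \<noteq> 0} \<times> {k. fls_nth g k \<noteq> 0})"
      by (intro image_eqI[of _ _ "(i, k - i)"]) auto
  qed
qed

lemma laurent_polynomial_power: "laurent_polynomial f \<Longrightarrow> laurent_polynomial (f ^ n)"
  by (induction n) (simp_all add: laurent_polynomial_1 laurent_polynomial_mult)

lemma laurent_polynomial_of_nat: "laurent_polynomial (of_nat n)"
  by (induction n) (simp_all add: laurent_polynomial_0 laurent_polynomial_1 laurent_polynomial_add)

lemma laurent_polynomial_numeral: "laurent_polynomial (numeral n)"
  using laurent_polynomial_of_nat[of "numeral n"] by simp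

lemmas laurent_polynomial_intros = laurent_polynomial_0 laurent_polynomial_1 laurent_polynomial_X
  laurent_polynomial_X_inv laurent_polynomial_add laurent_polynomial_uminus laurent_polynomial_diff
  laurent_polynomial_mult laurent_polynomial_power laurent_polynomial_numeral

section \<open>Polynomials in \<Phi> of bounded degree\<close>

definition Phi_polys :: "nat \<Rightarrow> int fls set" where
  "Phi_polys d = {\<Sum>i<d. a i * \<Phi> ^ i | a. \<forall>i<d. laurent_polynomial (a i)}"

lemma Phi_polysI:
  "(\<And>i. i < d \<Longrightarrow> laurent_polynomial (a i)) \<Longrightarrow> (\<Sum>i<d. a i * \<Phi> ^ i) \<in> Phi_polys d"
  unfolding Phi_polys_def by blast

lemma Phi_polys_monomial: "laurent_polynomial c \<Longrightarrow> i < d \<Longrightarrow> c * \<Phi> ^ i \<in> Phi_polys d"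
proof -
  assume c: "laurent_polynomial c" "i < d"
  define a where "a = (\<lambda>j. if j = i then c else 0)"
  have "(\<Sum>j<d. a j * \<Phi> ^ j) = (\<Sum>j<d. if j = i then c * \<Phi> ^ j else 0)"
    by (rule sum.cong) (auto simp: a_def)
  then have "c * \<Phi> ^ i = (\<Sum>j<d. a j * \<Phi> ^ j)" using c by simp
  moreover have "\<forall>j<d. laurent_polynomial (a j)"
    using c by (simp add: a_def laurent_polynomial_0)
  ultimately show ?thesis unfolding Phi_polys_def by blast
qed

lemma Phi_polys_add:
  assumes "f \<in> Phi_polys d" and "g \<in> Phi_polys d"
  shows "f + g \<in> Phi_polys d"
proof -
  obtain a b where f: "f = (\<Sum>i<d. a i * \<Phi> ^ i)" "\<forall>i<d. laurent_polynomial (a i)"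
    and g: "g = (\<Sum>i<d. b i * \<Phi> ^ i)" "\<forall>i<d. laurent_polynomial (b i)"
    using assms by (auto simp: Phi_polys_def)
  have "f + g = (\<Sum>i<d. (a i + b i) * \<Phi> ^ i)"
    unfolding f g by (simp add: sum.distrib distrib_right)
  also have "\<dots> \<in> Phi_polys d"
    using f g by (intro Phi_polysI) (simp add: laurent_polynomial_add)
  finally show ?thesis .
qed

lemma Phi_polys_0: "0 \<in> Phi_polys d"
  using Phi_polysI[of d "\<lambda>_. 0"] by (simp add: laurent_polynomial_0)

lemma Phi_polys_sum: "(\<And>i. i \<in> A \<Longrightarrow> f i \<in> Phi_polys d) \<Longrightarrow> sum f A \<in> Phi_polys d"
  by (induction A rule: infinite_finite_induct) (auto intro: Phi_polys_add Phi_polys_0)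

lemma Phi_polys_shift:
  assumes "f \<in> Phi_polys d"
  shows "\<Phi> ^ k * f \<in> Phi_polys (k + d)"
proof -
  obtain a where f: "f = (\<Sum>i<d. a i * \<Phi> ^ i)" "\<forall>i<d. laurent_polynomial (a i)"
    using assms by (auto simp: Phi_polys_def)
  have "\<Phi> ^ k * f = (\<Sum>i<d. a i * \<Phi> ^ (k + i))"
    unfolding f by (simp add: sum_distrib_left power_add mult_ac)
  also have "\<dots> \<in> Phi_polys (k + d)"
    using f(2) by (intro Phi_polys_sum Phi_polys_monomial) auto
  finally show ?thesis .
qed

lemma Phi_polys_mult:
  assumes "f \<in> Phi_polys m" and "g \<in> Phi_polys n"
  shows "f * g \<in> Phi_polys (m + n)"
proof -
  obtain a b where f: "f = (\<Sum>i<m. a i * \<Phi> ^ i)" "\<forall>i<m. laurent_polynomial (a i)"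
    and g: "g = (\<Sum>i<n. b i * \<Phi> ^ i)" "\<forall>i<n. laurent_polynomial (b i)"
    using assms by (auto simp: Phi_polys_def)
  have "f * g = (\<Sum>i<m. \<Sum>j<n. (a i * b j) * \<Phi> ^ (i + j))"
    unfolding f g sum_product by (simp add: power_add mult_ac)
  also have "\<dots> \<in> Phi_polys (m + n)"
    using f(2) g(2) by (intro Phi_polys_sum Phi_polys_monomial) (auto intro: laurent_polynomial_mult)
  finally show ?thesis .
qed

lemma Phi_polys_const_mult:
  assumes "laurent_polynomial c" and "f \<in> Phi_polys d"
  shows "c * f \<in> Phi_polys d"
proof -
  obtain a where f: "f = (\<Sum>i<d. a i * \<Phi> ^ i)" "\<forall>i<d. laurent_polynomial (a i)"
    using assms by (auto simp: Phi_polys_def)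
  have "c * f = (\<Sum>i<d. (c * a i) * \<Phi> ^ i)"
    unfolding f by (simp add: sum_distrib_left mult_ac)
  also have "\<dots> \<in> Phi_polys d"
    using f(2) assms(1) by (intro Phi_polys_sum Phi_polys_monomial) (auto intro: laurent_polynomial_mult)
  finally show ?thesis .
qed

text \<open>The polynomial is \<omega>^2 - 2 \<omega> + 4 z \<Phi> - 4 z^2. With \<omega> = 2 e it
  equals 4 (e^2 - e + z \<Phi> - z^2), whose bracket is even by
  \<open>\<omega>_quadratic\<close>.\<close>

lemma Phi_quartic: "\<exists>q\<in>Phi_polys 4. 8 dvd \<Phi> ^ 4 + q"
proof -
  obtain e h where e: "\<omega> = 2 * e" and h: "e ^ 2 = e - fls_X * \<Phi> + fls_X ^ 2 + 2 * h"
    by (rule \<omega>_quadratic)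
  define q where "q = (- 2 * fls_X - 3 * fls_X ^ 2) * \<Phi> ^ 0 + (2 + 2 * fls_X) * \<Phi> ^ 1
    + (2 * fls_X - 1) * \<Phi> ^ 2 + (- 2) * \<Phi> ^ 3"
  have "\<Phi> ^ 4 + q = \<omega> ^ 2 - 2 * \<omega> + 4 * fls_X * \<Phi> - 4 * fls_X ^ 2"
    unfolding q_def \<omega>_def
    by (simp add: power2_eq_square power3_eq_cube power4_eq_xxxx algebra_simps)
  also have "\<dots> = 4 * e ^ 2 - 4 * e + 4 * fls_X * \<Phi> - 4 * fls_X ^ 2"
    unfolding e by (simp add: power_mult_distrib)
  also have "\<dots> = 8 * h"
    unfolding h by (simp add: algebra_simps)
  finally have "8 dvd \<Phi> ^ 4 + q" by simp
  moreover have "q \<in> Phi_polys 4"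
    unfolding q_def
    by (intro Phi_polys_add Phi_polys_monomial laurent_polynomial_intros) auto
  ultimately show ?thesis by blast
qed

text \<open>The N-th power of the quartic is monic of degree 4 N in \<Phi> and divisible by
  8^N.\<close>

lemma Phi_relation:
  assumes "N > 0"
  shows "\<exists>r\<in>Phi_polys (4 * N). 2 ^ (3 * N) dvd \<Phi> ^ (4 * N) - r"
proof -
  obtain q where q: "q \<in> Phi_polys 4" "8 dvd \<Phi> ^ 4 + q" using Phi_quartic by blast
  have *: "\<exists>r\<in>Phi_polys (4 * N). (\<Phi> ^ 4 + q) ^ N = \<Phi> ^ (4 * N) - r" if "N > 0" for N
    using that
  proof (induction N rule: nat_induct_non_zero)
    case 1
    have "- 1 * q \<in> Phi_polys 4"
      using q(1) by (intro Phi_polys_const_mult laurent_polynomial_intros)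
    then show ?case by (intro bexI[of _ "- q"]) auto
  next
    case (Suc N)
    then obtain r where r: "r \<in> Phi_polys (4 * N)" "(\<Phi> ^ 4 + q) ^ N = \<Phi> ^ (4 * N) - r" by blast
    have expand: "(A + q) * (P - r) = A * P - (A * r + q * r + (- 1) * (P * q))" for A P
      by (simp add: algebra_simps)
    have "(\<Phi> ^ 4 + q) ^ Suc N = (\<Phi> ^ 4 + q) * (\<Phi> ^ (4 * N) - r)"
      by (simp add: r)
    also have "\<dots> = \<Phi> ^ (4 + 4 * N) - (\<Phi> ^ 4 * r + q * r + (- 1) * (\<Phi> ^ (4 * N) * q))"
      unfolding power_add expand ..
    finally have "(\<Phi> ^ 4 + q) ^ Suc N =
      \<Phi> ^ (4 * Suc N) - (\<Phi> ^ 4 * r + q * r + (- 1) * (\<Phi> ^ (4 * N) * q))"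
      by (simp only: mult_Suc_right)
    moreover have "4 * Suc N = 4 * N + 4" by simp
    moreover have "\<Phi> ^ 4 * r + q * r + (- 1) * (\<Phi> ^ (4 * N) * q) \<in> Phi_polys (4 * N + 4)"
    proof (intro Phi_polys_add)
      show "\<Phi> ^ 4 * r \<in> Phi_polys (4 * N + 4)"
        using Phi_polys_shift[OF r(1), of 4] by (simp add: add.commute)
      show "q * r \<in> Phi_polys (4 * N + 4)"
        using Phi_polys_mult[OF q(1) r(1)] by (simp add: add.commute)
      show "(- 1) * (\<Phi> ^ (4 * N) * q) \<in> Phi_polys (4 * N + 4)"
        by (rule Phi_polys_const_mult[OF _ Phi_polys_shift[OF q(1)]]) (intro laurent_polynomial_intros)
    qed
    ultimately show ?case by metis
  qed
  obtain r where "r \<in> Phi_polys (4 * N)" "(\<Phi> ^ 4 + q) ^ N = \<Phi> ^ (4 * N) - r"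
    using * assms by blast
  moreover have "2 ^ (3 * N) dvd (\<Phi> ^ 4 + q) ^ N"
    using dvd_power_same[OF q(2), of N] by (simp add: power_mult)
  ultimately show ?thesis by auto
qed

text \<open>The series congruent to a polynomial in \<Phi> of degree below 4 N contain the
  generators of the ring and are closed under its operations.\<close>

lemma Phi_ring_reduce:
  assumes "f \<in> Phi_ring (3 * N)" and "N > 0"
  shows "\<exists>p\<in>Phi_polys (4 * N). 2 ^ (3 * N) dvd f - p"
proof -
  define d where "d = 4 * N"
  define m where "m = (2 :: int fls) ^ (3 * N)"
  define R where "R = {f. \<exists>p\<in>Phi_polys d. m dvd f - p}"
  have RI: "f \<in> R" if "p \<in> Phi_polys d" "m dvd f - p" for f p
    using that by (auto simp: R_def)
  have poly: "p \<in> R" if "p \<in> Phi_polys d" for p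
    using that by (intro RI[of p]) auto
  have err: "m * f \<in> R" for f
    by (rule RI[OF Phi_polys_0]) simp
  have add: "f + g \<in> R" if fg: "f \<in> R" "g \<in> R" for f g
  proof -
    obtain p q where "p \<in> Phi_polys d" "m dvd f - p" "q \<in> Phi_polys d" "m dvd g - q"
      using fg by (auto simp: R_def)
    then show ?thesis
      using dvd_add[of m "f - p" "g - q"]
      by (intro RI[of "p + q"] Phi_polys_add) (auto simp: algebra_simps)
  qed
  have const: "c * f \<in> R" if cf: "laurent_polynomial c" "f \<in> R" for c f
  proof -
    obtain p where "p \<in> Phi_polys d" "m dvd f - p"
      using cf by (auto simp: R_def)
    then show ?thesis
      using dvd_mult[of m "f - p" c] cf
      by (intro RI[of "c * p"] Phi_polys_const_mult) (auto simp: right_diff_distrib)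
  qed
  have "\<Phi> ^ d \<in> R"
    using Phi_relation[OF assms(2)] by (auto simp: R_def d_def m_def)
  \<comment> \<open>Multiplication by \<Phi> moves only the top monomial out of range, to a multiple
    of \<open>\<Phi> ^ d\<close>, which \<open>Phi_relation\<close> brings back.\<close>
  then have shift: "\<Phi> * f \<in> R" if f: "f \<in> R" for f
  proof -
    assume top: "\<Phi> ^ d \<in> R"
    obtain p h where p: "p \<in> Phi_polys d" and "f - p = m * h"
      using f by (auto simp: R_def elim!: dvdE)
    then have fp: "f = p + m * h" by (simp add: algebra_simps)
    obtain a where a: "p = (\<Sum>i<d. a i * \<Phi> ^ i)" "\<forall>i<d. laurent_polynomial (a i)"
      using p by (auto simp: Phi_polys_def)
    have "a i * \<Phi> ^ Suc i \<in> R" if "i < d" for i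
    proof (cases "Suc i < d")
      case True
      then show ?thesis using a(2) that by (intro poly Phi_polys_monomial) auto
    next
      case False
      then have "Suc i = d" using that by simp
      then show ?thesis using a(2) that top by (auto intro: const)
    qed
    then have "(\<Sum>i\<in>A. a i * \<Phi> ^ Suc i) \<in> R" if "A \<subseteq> {..<d}" for A
      using that by (induction A rule: infinite_finite_induct) (auto intro: add poly Phi_polys_0)
    then have "(\<Sum>i<d. a i * \<Phi> ^ Suc i) + m * (\<Phi> * h) \<in> R"
      by (intro add err) auto
    then show ?thesis
      unfolding fp a by (simp add: sum_distrib_left algebra_simps)
  qed
  have pow: "\<Phi> ^ i * f \<in> R" if "f \<in> R" for i f
    using that by (induction i) (auto simp: mult.assoc intro: shift)
  have mult: "f * g \<in> R" if fg: "f \<in> R" "g \<in> R" for f g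
  proof -
    obtain p h where p: "p \<in> Phi_polys d" and "f - p = m * h"
      using fg by (auto simp: R_def elim!: dvdE)
    then have fp: "f = p + m * h" by (simp add: algebra_simps)
    obtain a where a: "p = (\<Sum>i<d. a i * \<Phi> ^ i)" "\<forall>i<d. laurent_polynomial (a i)"
      using p by (auto simp: Phi_polys_def)
    have "a i * (\<Phi> ^ i * g) \<in> R" if "i < d" for i
      using that a(2) fg by (intro const pow) auto
    then have "(\<Sum>i\<in>A. a i * (\<Phi> ^ i * g)) \<in> R" if "A \<subseteq> {..<d}" for A
      using that by (induction A rule: infinite_finite_induct) (auto intro: add poly Phi_polys_0)
    then have "(\<Sum>i<d. a i * (\<Phi> ^ i * g)) + m * (h * g) \<in> R"
      by (intro add err) auto
    then show ?thesis
      unfolding fp a distrib_right sum_distrib_right by (simp add: mult.assoc)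
  qed
  have one: "1 \<in> R"
    using poly[OF Phi_polys_monomial[OF laurent_polynomial_1, of 0 d]] assms(2) by (simp add: d_def)
  from assms(1) have "f \<in> R"
  proof (induction rule: Phi_ring.induct)
    case X
    then show ?case using const[OF laurent_polynomial_X one] by simp
  next
    case X_inv
    then show ?case using const[OF laurent_polynomial_X_inv one] by simp
  next
    case Phi
    then show ?case using shift[OF one] by simp
  next
    case (diff f g)
    then show ?case
      using add[OF _ const[OF laurent_polynomial_uminus[OF laurent_polynomial_1]], of f g] by simp
  qed (auto intro: one err[unfolded m_def] add mult)
  then show ?thesis by (auto simp: R_def d_def m_def)
qed


text \<open>Modulo 2 the difference of the two equations expresses d through z^3 c d, z^7 d' and z^7
  e, whose coefficients at z^n involve only earlier coefficients of d.\<close>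

lemma riccati_fps_unique_mod_2:
  fixes v d :: "int fps"
  assumes "2 dvd riccati (fps_to_fls (v + d))" and "2 dvd riccati (fps_to_fls v)"
  shows "2 dvd fps_to_fls d"
proof -
  define c where "c = 3 + 2 * fps_X + 7 * fps_X ^ 3 - 2 * fps_X ^ 4 - 4 * (fps_X :: int fps) ^ 6"
  define e where "e = (1 - fps_X ^ 3) * (2 * v + d) * d"
  define E where "E = fps_X ^ 3 * (c * d) + fps_X ^ 7 * fps_deriv d + fps_X ^ 7 * e - d"
  have to_fls: "fps_to_fls (x * y) = fps_to_fls x * fps_to_fls y" for x y :: "int fps"
    by (rule fls_times_fps_to_fls)
  have "2 dvd riccati (fps_to_fls (v + d)) - riccati (fps_to_fls v)"
    using assms by (rule dvd_diff)
  also have "riccati (fps_to_fls (v + d)) - riccati (fps_to_fls v) = fps_to_fls E"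
    unfolding E_def e_def c_def fps_to_fls_plus riccati_add lin_coeff_def
    by (simp add: to_fls fps_to_fls_power fls_deriv_fps_to_fls algebra_simps flip: power_add)
      (simp flip: power_Suc)
  finally have E: "2 dvd fps_nth E n" for n
    using fls_two_power_dvd_iff[of 1 "fps_to_fls E"] by (auto dest: spec[of _ "int n"])
  have "2 dvd fps_nth d n" for n
  proof (induction n rule: less_induct)
    case (less n)
    have mult: "2 dvd fps_nth (f * d) m" if "m < n" for m f
      unfolding fps_mult_nth using that less by (intro dvd_sum dvd_mult) auto
    have "2 dvd fps_nth (fps_X ^ 3 * (c * d)) n"
      unfolding fps_X_power_mult_nth using mult by auto
    moreover have "2 dvd fps_nth (fps_X ^ 7 * fps_deriv d) n"
      unfolding fps_X_power_mult_nth using less[of "n - 7 + 1"] by auto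
    moreover have "2 dvd fps_nth (fps_X ^ 7 * e) n"
      unfolding fps_X_power_mult_nth e_def using mult by auto
    ultimately have "2 dvd (fps_nth (fps_X ^ 3 * (c * d)) n + fps_nth (fps_X ^ 7 * fps_deriv d) n
        + fps_nth (fps_X ^ 7 * e) n) - fps_nth E n"
      using E[of n] by (intro dvd_diff dvd_add)
    then show ?case by (simp add: E_def)
  qed
  then show ?thesis
    using fls_two_power_dvd_iff[of 1 "fps_to_fls d"] by simp
qed

text \<open>Removing z, z^2 and z^4 from \<Phi> leaves a series starting at z^8. Only for power
  series is the solution modulo 2 known to be unique.\<close>

lemma base_solution_fps: "\<exists>v. base_solution = fps_to_fls v"
proof -
  define u where "u = Phi_fps - fps_X - fps_X ^ 2 - fps_X ^ 4"
  have pow: "(\<exists>j. n = 2 ^ j) \<longleftrightarrow> n = 1 \<or> n = 2 \<or> n = 4" if "n < 7" for n :: nat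
  proof
    assume "\<exists>j. n = 2 ^ j"
    then obtain j where j: "n = 2 ^ j" by blast
    have "j < 3"
    proof (rule ccontr)
      assume "\<not> j < 3"
      then have "(2 :: nat) ^ 3 \<le> 2 ^ j" by (intro power_increasing) auto
      then show False using that j by simp
    qed
    then show "n = 1 \<or> n = 2 \<or> n = 4" using j by (auto simp: less_Suc_eq eval_nat_numeral)
  next
    assume "n = 1 \<or> n = 2 \<or> n = 4"
    then have "n = 2 ^ 0 \<or> n = 2 ^ 1 \<or> n = 2 ^ 2" by simp
    then show "\<exists>j. n = 2 ^ j" by blast
  qed
  have u: "fps_nth u n = 0" if "n < 7" for n
    using pow[OF that] unfolding u_def Phi_fps_def by (auto simp: fps_X_power_nth fps_X_nth)
  have "fps_X ^ 7 * fps_shift 7 u = u"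
    by (intro fps_ext) (use u in \<open>auto simp: fps_X_power_mult_nth\<close>)
  then have "fps_to_fls u = fls_X ^ 7 * fps_to_fls (fps_shift 7 u)"
    by (metis fls_times_fps_to_fls fps_X_to_fls fps_to_fls_power)
  moreover have "fls_X_inv ^ 7 * (fls_X ^ 7 * f) = f" for f :: "int fls"
    by (simp only: fls_X_power_times_X_inv_power mult.assoc[symmetric] mult.commute[of "fls_X_inv ^ 7"] mult_1)
  moreover have "base_solution = fls_X_inv ^ 7 * fps_to_fls u"
    by (simp add: base_solution_def u_def \<Phi>_def fps_to_fls_power)
  ultimately have "base_solution = fps_to_fls (fps_shift 7 u)" by (simp only:)
  then show ?thesis ..
qed

text \<open>Modulo 2 the solution agrees with \<open>base_solution\<close>, hence with the Newton
  approximation f modulo 2^M; f is then reduced to low degree in \<Phi>.\<close>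

theorem riccati_solution_Phi_poly:
  assumes "riccati (fps_to_fls w) = 0" and "N > 0"
  shows "\<exists>p\<in>Phi_polys (4 * N). 2 ^ (3 * N) dvd fps_to_fls w - p"
proof -
  define M where "M = 3 * N"
  obtain K where K: "M = Suc K" using assms(2) by (cases M) (auto simp: M_def)
  obtain f where f: "f \<in> Phi_ring M" "riccati f \<in> Phi_ideal M M" "2 dvd f - base_solution"
    using riccati_approx[of M K] by (auto simp: K)
  obtain v where v: "base_solution = fps_to_fls v" using base_solution_fps by blast
  have "2 dvd riccati (fps_to_fls v)"
    using Phi_ideal_imp_dvd[OF riccati_base_solution] by (simp add: v)
  then have "2 dvd fps_to_fls (w - v)"
    using assms(1) by (intro riccati_fps_unique_mod_2[of v]) auto
  then have "2 dvd fps_to_fls w - base_solution" by (simp add: v)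
  from dvd_diff[OF this f(3)] have "2 dvd fps_to_fls w - f" by simp
  moreover have "2 ^ M dvd riccati f" using f(2) by (rule Phi_ideal_imp_dvd)
  ultimately have *: "2 ^ M dvd fps_to_fls w - f"
    using assms(1) by (intro riccati_solution_unique) auto
  obtain p where "p \<in> Phi_polys (4 * N)" "2 ^ M dvd f - p"
    using Phi_ring_reduce[of f N] f(1) assms(2) by (auto simp: M_def)
  then show ?thesis using dvd_add[OF * \<open>2 ^ M dvd f - p\<close>] by (auto simp: M_def)
qed

section \<open>The generating function of the subgroup numbers\<close>

text \<open>The exponential generating function has denominators, whereas S is integral; this
  embedding carries the equation back to the integers.\<close>

definition int_to_rat_fps :: "int fps \<Rightarrow> rat fps" where
  "int_to_rat_fps f = Abs_fps (\<lambda>n. of_int (fps_nth f n))"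

lemma int_to_rat_fps_simps [simp]:
  "int_to_rat_fps 0 = 0" "int_to_rat_fps 1 = 1" "int_to_rat_fps (numeral k) = numeral k"
  "int_to_rat_fps fps_X = fps_X"
  "int_to_rat_fps (f + g) = int_to_rat_fps f + int_to_rat_fps g"
  "int_to_rat_fps (f - g) = int_to_rat_fps f - int_to_rat_fps g"
  "int_to_rat_fps (- f) = - int_to_rat_fps f"
  "int_to_rat_fps (f * g) = int_to_rat_fps f * int_to_rat_fps g"
  "int_to_rat_fps (fps_deriv f) = fps_deriv (int_to_rat_fps f)"
  by (rule fps_ext; simp add: int_to_rat_fps_def fps_mult_nth fps_X_def fps_numeral_nth)+

lemma int_to_rat_fps_power [simp]: "int_to_rat_fps (f ^ n) = int_to_rat_fps f ^ n"
  by (induction n) simp_all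

lemma int_to_rat_fps_eq_0_iff [simp]: "int_to_rat_fps f = 0 \<longleftrightarrow> f = 0"
  by (auto simp: int_to_rat_fps_def fps_eq_iff)

definition S_fps :: "int fps" where
  "S_fps = Abs_fps (\<lambda>n. int (subgroup_count PSL2Z (n + 1)))"

text \<open>S is the logarithmic derivative of H: substitute H' = H S and H'' = H (S' + S^2) and
  cancel H, whose constant term is 1.\<close>

lemma S_riccati:
  "(- 1 + 4 * fps_X ^ 3 + 2 * fps_X ^ 4 + 4 * fps_X ^ 6 - 2 * fps_X ^ 7 - 4 * fps_X ^ 9) * S_fps
   + (fps_X ^ 7 - fps_X ^ 10) * (fps_deriv S_fps + S_fps ^ 2)
   + (1 + fps_X + 4 * fps_X ^ 2 + 4 * fps_X ^ 3 - fps_X ^ 4 + 4 * fps_X ^ 5 - 2 * fps_X ^ 6 - 2 * fps_X ^ 8)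
   = 0" (is "?E = 0")
proof -
  define s where "s = int_to_rat_fps S_fps"
  have d: "fps_deriv pair_egf = pair_egf * s"
    unfolding pair_egf_deriv by (simp add: s_def S_fps_def int_to_rat_fps_def)
  have dd: "fps_deriv (fps_deriv pair_egf) = pair_egf * (fps_deriv s + s ^ 2)"
    unfolding d by (simp add: d power2_eq_square algebra_simps)
  have E: "int_to_rat_fps ?E =
      (- 1 + 4 * fps_X ^ 3 + 2 * fps_X ^ 4 + 4 * fps_X ^ 6 - 2 * fps_X ^ 7 - 4 * fps_X ^ 9) * s
      + (fps_X ^ 7 - fps_X ^ 10) * (fps_deriv s + s ^ 2)
      + (1 + fps_X + 4 * fps_X ^ 2 + 4 * fps_X ^ 3 - fps_X ^ 4 + 4 * fps_X ^ 5 - 2 * fps_X ^ 6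
         - 2 * fps_X ^ 8)"
    by (simp add: s_def)
  have "c * (p * x + q * y + r) = q * (c * y) + p * (c * x) + r * c" for c p q r x y :: "rat fps"
    by (simp add: algebra_simps)
  then have "pair_egf * int_to_rat_fps ?E = 0"
    unfolding E using pair_egf_ode[unfolded dd, unfolded d] by (simp only:)
  moreover have "fps_nth pair_egf 0 = 1" by (simp add: pair_egf_def)
  then have "pair_egf \<noteq> 0" by auto
  ultimately have "int_to_rat_fps ?E = 0" by (simp only: mult_eq_0_iff simp_thms)
  then show ?thesis by (simp only: int_to_rat_fps_eq_0_iff)
qed

text \<open>The second factor is the geometric series 1 / (1 - z^3), so W is integral.\<close>

definition W_fps :: "int fps" where
  "W_fps = (S_fps + 1 + 2 * fps_X ^ 2) * Abs_fps (\<lambda>n. if 3 dvd n then 1 else 0)"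

lemma S_eq_W: "S_fps = (1 - fps_X ^ 3) * W_fps - 1 - 2 * fps_X ^ 2"
proof -
  have "(1 - fps_X ^ 3) * Abs_fps (\<lambda>n. if 3 dvd n then 1 else 0) = (1 :: int fps)"
  proof (rule fps_ext)
    fix n :: nat
    show "fps_nth ((1 - fps_X ^ 3) * Abs_fps (\<lambda>n. if 3 dvd n then 1 else 0)) n = fps_nth (1 :: int fps) n"
    proof (cases "n < 3")
      case True
      then have "3 dvd n \<longleftrightarrow> n = 0" by (auto dest: dvd_imp_le)
      with True show ?thesis by (simp add: left_diff_distrib fps_X_power_mult_nth)
    next
      case False
      then have "3 dvd n - 3 \<longleftrightarrow> 3 dvd n" by presburger
      with False show ?thesis by (simp add: left_diff_distrib fps_X_power_mult_nth)
    qed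
  qed
  then have "(1 - fps_X ^ 3) * W_fps = S_fps + 1 + 2 * fps_X ^ 2"
    unfolding W_fps_def by (simp add: mult.left_commute)
  then show ?thesis by simp
qed

text \<open>After the substitution the left-hand side of \<open>S_riccati\<close> is (1 - z^3)^2
  times the new one, and this factor cancels in the domain of power series.\<close>

lemma W_riccati: "riccati (fps_to_fls W_fps) = 0"
proof -
  define w where "w = W_fps"
  define E where "E = (- 1 + 3 * fps_X ^ 3 + 2 * fps_X ^ 4 + 7 * fps_X ^ 6 - 2 * fps_X ^ 7 - 4 * fps_X ^ 9) * w
     + fps_X ^ 7 * fps_deriv w + (fps_X ^ 7 - fps_X ^ 10) * w ^ 2
     + (2 + fps_X + 6 * fps_X ^ 2 + 4 * fps_X ^ 3 - fps_X ^ 4 + 8 * fps_X ^ 5 - 4 * fps_X ^ 6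
        - 4 * fps_X ^ 8)"
  have d: "fps_deriv S_fps = (1 - fps_X ^ 3) * fps_deriv w - 3 * fps_X ^ 2 * w - 4 * fps_X"
    unfolding S_eq_W w_def[symmetric]
    by (simp add: fps_deriv_power power2_eq_square eval_nat_numeral algebra_simps)
  have "(1 - fps_X ^ 3) * ((1 - fps_X ^ 3) * E) = 0"
    unfolding S_riccati[symmetric] d E_def unfolding S_eq_W w_def[symmetric] by algebra
  moreover have "fps_nth (1 - fps_X ^ 3 :: int fps) 0 = 1" by simp
  then have "1 - fps_X ^ 3 \<noteq> (0 :: int fps)" by (metis fps_zero_nth zero_neq_one)
  ultimately have "E = 0" by simp
  moreover have "riccati (fps_to_fls w) = fps_to_fls E"
    unfolding riccati_def lin_coeff_def E_def
    by (simp add: fls_times_fps_to_fls fps_to_fls_power fls_deriv_fps_to_fls)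
  ultimately show ?thesis by (simp add: w_def)
qed

theorem theorem21:
  fixes \<alpha> :: nat
  assumes "\<alpha> > 0"
  shows "\<exists>a :: nat \<Rightarrow> int fls.
           (\<forall>i\<in>{0..2 ^ (\<alpha> + 2) - 1}. laurent_polynomial (a i)) \<and>
           fls_cong S_PSL2Z (\<Sum>i = 0..2 ^ (\<alpha> + 2) - 1. a i * \<Phi> ^ i) (2 ^ (3 * 2 ^ \<alpha>))"
proof -
  define d :: nat where "d = 4 * 2 ^ \<alpha>"
  obtain p where p: "p \<in> Phi_polys d" "2 ^ (3 * 2 ^ \<alpha>) dvd fps_to_fls W_fps - p"
    using riccati_solution_Phi_poly[OF W_riccati, of "2 ^ \<alpha>"] by (auto simp: d_def)
  have d: "d > 0" by (simp add: d_def)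
  \<comment> \<open>Going back from W to S multiplies by a Laurent polynomial and adds one, so the
    degree in \<Phi> stays below d.\<close>
  define q where "q = (1 - fls_X ^ 3) * p + (- 1 - 2 * fls_X ^ 2) * \<Phi> ^ 0"
  have "q \<in> Phi_polys d"
    unfolding q_def using d p(1)
    by (intro Phi_polys_add Phi_polys_monomial Phi_polys_const_mult laurent_polynomial_intros)
  then obtain a where a: "q = (\<Sum>i<d. a i * \<Phi> ^ i)" "\<forall>i<d. laurent_polynomial (a i)"
    by (auto simp: Phi_polys_def)
  have "S_PSL2Z = fps_to_fls S_fps" by (simp add: S_PSL2Z_def S_fps_def)
  also have "\<dots> = (1 - fls_X ^ 3) * fps_to_fls W_fps - 1 - 2 * fls_X ^ 2"
    by (subst S_eq_W) (simp add: fls_times_fps_to_fls fps_to_fls_power)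
  finally have "S_PSL2Z - q = (1 - fls_X ^ 3) * (fps_to_fls W_fps - p)"
    by (simp add: q_def algebra_simps)
  then have "2 ^ (3 * 2 ^ \<alpha>) dvd S_PSL2Z - q" using p(2) by simp
  then have "fls_cong S_PSL2Z q (2 ^ (3 * 2 ^ \<alpha>))" by (simp only: fls_cong_iff_dvd)
  moreover have "2 ^ (\<alpha> + 2) = d" by (simp add: d_def power_add)
  moreover have "{0..d - 1} = {..<d}"
    using d by (cases d) (auto simp: less_Suc_eq_le)
  ultimately show ?thesis using a by (intro exI[of _ a]) (simp only: lessThan_iff ball_simps, simp)
qed

end
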